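(* Every ground eventuality monodic temporal problem can be reduced (by an effective transformation) to a satisfiability equivalent grounded monodic temporal problem with an exponential growth in size of the given problem (i.e. the size of the resulting problem is at most exponential in the size of the given one).
   Context: First-order temporal logic (no function symbols, no equality; constants allowed), constant domains: a temporal structure is $\mathfrak M=\langle D,I\rangle$ with $D\ne\emptyset$ and first-order structures $\mathfrak M_n=\langle D,I_n\rangle$, $n\in\mathbb N$; constants are rigid (same interpretation at all $n$), predicates are flexible. $\bigcirc\phi$ holds at $n$ iff $\phi$ holds at $n+1$; $\Diamond\phi$ (resp. $\Box\phi$) holds at $n$ iff $\phi$ holds at some (resp. all) $m\ge n$. A formula is satisfiable if it holds at moment $0$ in some structure under some assignment. A monodic temporal problem is a quadruple $\mathsf P=\langle\mathcal U,\mathcal I,\mathcal S,\mathcal E\rangle$: $\mathcal U$ and $\mathcal I$ are finite sets of closed first-order formulae; $\mathcal S$ is a finite set of step clauses, ground $l\Rightarrow\bigcirc m$ ($l,m$ propositional literals) or non-ground $L(x)\Rightarrow\bigcirc M(x)$ ($L(x),M(x)$ unary literals), no two different ones with the same left-hand side; $\mathcal E$ is a finite set of eventuality clauses, ground $\Diamond l$ ($l$ a propositional literal) or non-ground $\Diamond L(x)$ ($L(x)$ a unary literal). It is identified with the formula $\mathcal I\wedge\Box\mathcal U\wedge\Box\forall x\,\mathcal S\wedge\Box\forall x\,\mathcal E$. Two problems are satisfiability equivalent if either both or neither is satisfiable. A temporal problem is a ground eventuality problem if all its eventuality clauses are ground; it is grounded if all its step clauses and all its eventuality clauses are ground. *)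

theory Defs
  imports Main "HOL-Library.Nat_Bijection" "HOL-Library.Countable_Set"
begin

section \<open>First-order temporal logic over constant domains\<close>

datatype tm = Var nat | Const nat

text \<open>A predicate symbol is a name together with an arity, the arity being the length of the
  argument list.  Hence \<^term>\<open>p\<close> used with no argument and \<^term>\<open>p\<close> used with one argument are
  different symbols, and propositional symbols are the predicate symbols of arity 0.\<close>

datatype fm =
    Atom nat "tm list"
  | Top
  | Bot
  | Neg fm
  | Conj fm fm
  | Disj fm fm
  | Imp fm fm
  | Iff fm fm
  | Forall nat fm
  | Exists nat fm
  | Next fm
  | Sometime fm
  | Always fm

primrec tm_vars :: "tm \<Rightarrow> nat set" where
  "tm_vars (Var x) = {x}"
| "tm_vars (Const c) = {}"

primrec fv :: "fm \<Rightarrow> nat set" where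
  "fv (Atom p ts) = \<Union> (tm_vars ` set ts)"
| "fv Top = {}"
| "fv Bot = {}"
| "fv (Neg \<phi>) = fv \<phi>"
| "fv (Conj \<phi> \<psi>) = fv \<phi> \<union> fv \<psi>"
| "fv (Disj \<phi> \<psi>) = fv \<phi> \<union> fv \<psi>"
| "fv (Imp \<phi> \<psi>) = fv \<phi> \<union> fv \<psi>"
| "fv (Iff \<phi> \<psi>) = fv \<phi> \<union> fv \<psi>"
| "fv (Forall x \<phi>) = fv \<phi> - {x}"
| "fv (Exists x \<phi>) = fv \<phi> - {x}"
| "fv (Next \<phi>) = fv \<phi>"
| "fv (Sometime \<phi>) = fv \<phi>"
| "fv (Always \<phi>) = fv \<phi>"

primrec first_order :: "fm \<Rightarrow> bool" where
  "first_order (Atom p ts) = True"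
| "first_order Top = True"
| "first_order Bot = True"
| "first_order (Neg \<phi>) = first_order \<phi>"
| "first_order (Conj \<phi> \<psi>) = (first_order \<phi> \<and> first_order \<psi>)"
| "first_order (Disj \<phi> \<psi>) = (first_order \<phi> \<and> first_order \<psi>)"
| "first_order (Imp \<phi> \<psi>) = (first_order \<phi> \<and> first_order \<psi>)"
| "first_order (Iff \<phi> \<psi>) = (first_order \<phi> \<and> first_order \<psi>)"
| "first_order (Forall x \<phi>) = first_order \<phi>"
| "first_order (Exists x \<phi>) = first_order \<phi>"
| "first_order (Next \<phi>) = False"
| "first_order (Sometime \<phi>) = False"
| "first_order (Always \<phi>) = False"

text \<open>The size of a formula is its number of symbol occurrences.\<close>

primrec fm_size :: "fm \<Rightarrow> nat" where
  "fm_size (Atom p ts) = 1 + length ts"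
| "fm_size Top = 1"
| "fm_size Bot = 1"
| "fm_size (Neg \<phi>) = 1 + fm_size \<phi>"
| "fm_size (Conj \<phi> \<psi>) = 1 + fm_size \<phi> + fm_size \<psi>"
| "fm_size (Disj \<phi> \<psi>) = 1 + fm_size \<phi> + fm_size \<psi>"
| "fm_size (Imp \<phi> \<psi>) = 1 + fm_size \<phi> + fm_size \<psi>"
| "fm_size (Iff \<phi> \<psi>) = 1 + fm_size \<phi> + fm_size \<psi>"
| "fm_size (Forall x \<phi>) = 2 + fm_size \<phi>"
| "fm_size (Exists x \<phi>) = 2 + fm_size \<phi>"
| "fm_size (Next \<phi>) = 1 + fm_size \<phi>"
| "fm_size (Sometime \<phi>) = 1 + fm_size \<phi>"
| "fm_size (Always \<phi>) = 1 + fm_size \<phi>"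

text \<open>The domain and the constants do not depend on the moment of time; the predicates do.\<close>

record 'd tstruct =
  domain_of :: "'d set"
  const_of :: "nat \<Rightarrow> 'd"
  pred_of :: "nat \<Rightarrow> nat \<Rightarrow> 'd list \<Rightarrow> bool"  \<comment> \<open>moment, predicate name, arguments\<close>

definition temporal_structure :: "'d tstruct \<Rightarrow> bool" where
  "temporal_structure M \<longleftrightarrow> domain_of M \<noteq> {} \<and> range (const_of M) \<subseteq> domain_of M"

primrec tm_val :: "'d tstruct \<Rightarrow> (nat \<Rightarrow> 'd) \<Rightarrow> tm \<Rightarrow> 'd" where
  "tm_val M a (Var x) = a x"
| "tm_val M a (Const c) = const_of M c"

primrec holds :: "'d tstruct \<Rightarrow> nat \<Rightarrow> (nat \<Rightarrow> 'd) \<Rightarrow> fm \<Rightarrow> bool" where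
  "holds M n a (Atom p ts) \<longleftrightarrow> pred_of M n p (map (tm_val M a) ts)"
| "holds M n a Top \<longleftrightarrow> True"
| "holds M n a Bot \<longleftrightarrow> False"
| "holds M n a (Neg \<phi>) \<longleftrightarrow> \<not> holds M n a \<phi>"
| "holds M n a (Conj \<phi> \<psi>) \<longleftrightarrow> holds M n a \<phi> \<and> holds M n a \<psi>"
| "holds M n a (Disj \<phi> \<psi>) \<longleftrightarrow> holds M n a \<phi> \<or> holds M n a \<psi>"
| "holds M n a (Imp \<phi> \<psi>) \<longleftrightarrow> (holds M n a \<phi> \<longrightarrow> holds M n a \<psi>)"
| "holds M n a (Iff \<phi> \<psi>) \<longleftrightarrow> (holds M n a \<phi> \<longleftrightarrow> holds M n a \<psi>)"
| "holds M n a (Forall x \<phi>) \<longleftrightarrow> (\<forall>d\<in>domain_of M. holds M n (a(x := d)) \<phi>)"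
| "holds M n a (Exists x \<phi>) \<longleftrightarrow> (\<exists>d\<in>domain_of M. holds M n (a(x := d)) \<phi>)"
| "holds M n a (Next \<phi>) \<longleftrightarrow> holds M (Suc n) a \<phi>"
| "holds M n a (Sometime \<phi>) \<longleftrightarrow> (\<exists>m\<ge>n. holds M m a \<phi>)"
| "holds M n a (Always \<phi>) \<longleftrightarrow> (\<forall>m\<ge>n. holds M m a \<phi>)"

text \<open>A formula of HOL cannot quantify over all types, so the domain is taken to be a nonempty set
  of natural numbers.  By the theorem \<open>satisfiable_if_holds\<close> below (a downward
  Loewenheim-Skolem theorem) this is no restriction: a formula that holds at moment 0 in a
  structure whose domain is a set of any type whatsoever is satisfiable in this sense.\<close>

definition satisfiable :: "fm \<Rightarrow> bool" where
  "satisfiable \<phi> \<longleftrightarrow> (\<exists>(M :: nat tstruct) a.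
     temporal_structure M \<and> range a \<subseteq> domain_of M \<and> holds M 0 a \<phi>)"


section \<open>Goedel numbering of formulae\<close>

primrec tm_code :: "tm \<Rightarrow> nat" where
  "tm_code (Var x) = prod_encode (0, x)"
| "tm_code (Const c) = prod_encode (1, c)"

primrec fm_code :: "fm \<Rightarrow> nat" where
  "fm_code (Atom p ts) = prod_encode (0, prod_encode (p, list_encode (map tm_code ts)))"
| "fm_code Top = prod_encode (1, 0)"
| "fm_code Bot = prod_encode (2, 0)"
| "fm_code (Neg \<phi>) = prod_encode (3, fm_code \<phi>)"
| "fm_code (Conj \<phi> \<psi>) = prod_encode (4, prod_encode (fm_code \<phi>, fm_code \<psi>))"
| "fm_code (Disj \<phi> \<psi>) = prod_encode (5, prod_encode (fm_code \<phi>, fm_code \<psi>))"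
| "fm_code (Imp \<phi> \<psi>) = prod_encode (6, prod_encode (fm_code \<phi>, fm_code \<psi>))"
| "fm_code (Iff \<phi> \<psi>) = prod_encode (7, prod_encode (fm_code \<phi>, fm_code \<psi>))"
| "fm_code (Forall x \<phi>) = prod_encode (8, prod_encode (x, fm_code \<phi>))"
| "fm_code (Exists x \<phi>) = prod_encode (9, prod_encode (x, fm_code \<phi>))"
| "fm_code (Next \<phi>) = prod_encode (10, fm_code \<phi>)"
| "fm_code (Sometime \<phi>) = prod_encode (11, fm_code \<phi>)"
| "fm_code (Always \<phi>) = prod_encode (12, fm_code \<phi>)"

lemma tm_code_eq_iff: "tm_code s = tm_code t \<longleftrightarrow> s = t"
  by (cases s; cases t) auto

lemma inj_tm_code: "inj tm_code"
  by (simp add: inj_def tm_code_eq_iff)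

lemma fm_code_eq_iff: "fm_code \<phi> = fm_code \<psi> \<longleftrightarrow> \<phi> = \<psi>"
proof (induction \<phi> arbitrary: \<psi>)
  case (Atom p ts)
  show ?case
    by (cases \<psi>) (auto simp: list_encode_eq inj_map_eq_map[OF inj_tm_code])
qed (case_tac \<psi>; auto)+

lemma inj_fm_code: "inj fm_code"
  by (simp add: inj_def fm_code_eq_iff)

text \<open>The conjunction of a finite set of formulae, written in increasing order of Goedel
  numbers.\<close>

definition big_conj :: "fm set \<Rightarrow> fm" where
  "big_conj A = foldr Conj (map (inv fm_code) (sorted_list_of_set (fm_code ` A))) Top"

lemma holds_big_conj:
  assumes "finite A"
  shows "holds M n a (big_conj A) \<longleftrightarrow> (\<forall>\<phi>\<in>A. holds M n a \<phi>)"
proof -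
  have "set (map (inv fm_code) (sorted_list_of_set (fm_code ` A))) = A"
    using assms by (simp add: image_image inv_f_f[OF inj_fm_code])
  moreover have "holds M n a (foldr Conj xs Top) \<longleftrightarrow> (\<forall>\<phi>\<in>set xs. holds M n a \<phi>)" for xs
    by (induction xs) auto
  ultimately show ?thesis
    by (simp add: big_conj_def)
qed


section \<open>Monodic temporal problems\<close>

datatype lit = Pos nat | Negative nat

primrec lit_fm :: "lit \<Rightarrow> tm list \<Rightarrow> fm" where
  "lit_fm (Pos p) ts = Atom p ts"
| "lit_fm (Negative p) ts = Neg (Atom p ts)"

text \<open>A literal stands for a propositional literal in the ground constructors, and for a unary
  literal applied to the variable \<open>x\<close>, which is \<^term>\<open>Var 0\<close>, in the non-ground ones.\<close>

datatype step_clause = GroundStep lit lit | NonGroundStep lit lit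

datatype eventuality = GroundEv lit | NonGroundEv lit

primrec step_lhs :: "step_clause \<Rightarrow> fm" where
  "step_lhs (GroundStep l m) = lit_fm l []"
| "step_lhs (NonGroundStep l m) = lit_fm l [Var 0]"

primrec step_rhs :: "step_clause \<Rightarrow> fm" where
  "step_rhs (GroundStep l m) = lit_fm m []"
| "step_rhs (NonGroundStep l m) = lit_fm m [Var 0]"

definition step_fm :: "step_clause \<Rightarrow> fm" where
  "step_fm s = Imp (step_lhs s) (Next (step_rhs s))"

primrec eventuality_fm :: "eventuality \<Rightarrow> fm" where
  "eventuality_fm (GroundEv l) = Sometime (lit_fm l [])"
| "eventuality_fm (NonGroundEv l) = Sometime (lit_fm l [Var 0])"

primrec ground_step :: "step_clause \<Rightarrow> bool" where
  "ground_step (GroundStep l m) = True"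
| "ground_step (NonGroundStep l m) = False"

primrec ground_ev :: "eventuality \<Rightarrow> bool" where
  "ground_ev (GroundEv l) = True"
| "ground_ev (NonGroundEv l) = False"

record problem =
  universal_part :: "fm set"
  initial_part :: "fm set"
  step_part :: "step_clause set"
  eventuality_part :: "eventuality set"

definition monodic_problem :: "problem \<Rightarrow> bool" where
  "monodic_problem P \<longleftrightarrow>
     finite (universal_part P) \<and> finite (initial_part P) \<and>
     finite (step_part P) \<and> finite (eventuality_part P) \<and>
     (\<forall>\<phi>\<in>universal_part P \<union> initial_part P. first_order \<phi> \<and> fv \<phi> = {}) \<and>
     (\<forall>s\<in>step_part P. \<forall>t\<in>step_part P. s \<noteq> t \<longrightarrow> step_lhs s \<noteq> step_lhs t)"

definition ground_eventuality_problem :: "problem \<Rightarrow> bool" where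
  "ground_eventuality_problem P \<longleftrightarrow> monodic_problem P \<and> (\<forall>e\<in>eventuality_part P. ground_ev e)"

definition grounded_problem :: "problem \<Rightarrow> bool" where
  "grounded_problem P \<longleftrightarrow> monodic_problem P \<and>
     (\<forall>s\<in>step_part P. ground_step s) \<and> (\<forall>e\<in>eventuality_part P. ground_ev e)"

definition problem_fm :: "problem \<Rightarrow> fm" where
  "problem_fm P =
     Conj (big_conj (initial_part P))
    (Conj (Always (big_conj (universal_part P)))
    (Conj (Always (Forall 0 (big_conj (step_fm ` step_part P))))
          (Always (Forall 0 (big_conj (eventuality_fm ` eventuality_part P))))))"

definition satisfiability_equivalent :: "problem \<Rightarrow> problem \<Rightarrow> bool" where
  "satisfiability_equivalent P Q \<longleftrightarrow> (satisfiable (problem_fm P) \<longleftrightarrow> satisfiable (problem_fm Q))"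

definition problem_size :: "problem \<Rightarrow> nat" where
  "problem_size P = fm_size (problem_fm P)"


section \<open>Effective transformations of problems\<close>

text \<open>The (total) recursive functions of each arity \<open>n\<close>, as the least class containing the basic
  functions and closed under composition, primitive recursion and regular minimization.  An
  \<open>n\<close>-ary function is a function on lists of which only the values at lists of length \<open>n\<close>
  matter; rule \<open>rec_ext\<close> expresses the latter.\<close>

inductive recursive :: "nat \<Rightarrow> (nat list \<Rightarrow> nat) \<Rightarrow> bool" where
  rec_zero: "recursive n (\<lambda>xs. 0)"
| rec_succ: "recursive 1 (\<lambda>xs. Suc (xs ! 0))"
| rec_proj: "i < n \<Longrightarrow> recursive n (\<lambda>xs. xs ! i)"
| rec_comp: "recursive (length gs) f \<Longrightarrow> (\<forall>g\<in>set gs. recursive n g)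
    \<Longrightarrow> recursive n (\<lambda>xs. f (map (\<lambda>g. g xs) gs))"
| rec_prim: "recursive n f \<Longrightarrow> recursive (n + 2) g
    \<Longrightarrow> recursive (n + 1) (\<lambda>xs. rec_nat (f (tl xs)) (\<lambda>k r. g (k # r # tl xs)) (hd xs))"
| rec_minimize: "recursive (n + 1) f \<Longrightarrow> (\<forall>xs. length xs = n \<longrightarrow> (\<exists>k. f (k # xs) = 0))
    \<Longrightarrow> recursive n (\<lambda>xs. LEAST k. f (k # xs) = 0)"
| rec_ext: "recursive n f \<Longrightarrow> (\<forall>xs. length xs = n \<longrightarrow> f xs = g xs) \<Longrightarrow> recursive n g"

primrec lit_code :: "lit \<Rightarrow> nat" where
  "lit_code (Pos p) = prod_encode (0, p)"
| "lit_code (Negative p) = prod_encode (1, p)"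

primrec step_code :: "step_clause \<Rightarrow> nat" where
  "step_code (GroundStep l m) = prod_encode (0, prod_encode (lit_code l, lit_code m))"
| "step_code (NonGroundStep l m) = prod_encode (1, prod_encode (lit_code l, lit_code m))"

primrec eventuality_code :: "eventuality \<Rightarrow> nat" where
  "eventuality_code (GroundEv l) = prod_encode (0, lit_code l)"
| "eventuality_code (NonGroundEv l) = prod_encode (1, lit_code l)"

text \<open>Finite sets are coded by their canonical indices: \<^term>\<open>set_encode A\<close> is the sum of
  \<open>2 ^ n\<close> over the elements \<open>n\<close> of \<open>A\<close>.\<close>

definition problem_code :: "problem \<Rightarrow> nat" where
  "problem_code P = list_encode
     [set_encode (fm_code ` universal_part P), set_encode (fm_code ` initial_part P),
      set_encode (step_code ` step_part P), set_encode (eventuality_code ` eventuality_part P)]"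

definition effective_on :: "problem set \<Rightarrow> (problem \<Rightarrow> problem) \<Rightarrow> bool" where
  "effective_on A F \<longleftrightarrow>
     (\<exists>h. recursive 1 h \<and> (\<forall>P\<in>A. h [problem_code P] = problem_code (F P)))"

lemma lit_code_eq_iff: "lit_code l = lit_code m \<longleftrightarrow> l = m"
  by (cases l; cases m) auto

lemma inj_step_code: "inj step_code"
  unfolding inj_def
proof (intro allI impI)
  fix s t :: step_clause
  assume "step_code s = step_code t"
  then show "s = t"
    by (cases s; cases t) (auto simp: lit_code_eq_iff)
qed

lemma inj_eventuality_code: "inj eventuality_code"
  unfolding inj_def
proof (intro allI impI)
  fix s t :: eventuality
  assume "eventuality_code s = eventuality_code t"
  then show "s = t"
    by (cases s; cases t) (auto simp: lit_code_eq_iff)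
qed

lemma inj_on_problem_code: "inj_on problem_code {P. monodic_problem P}"
proof (rule inj_onI)
  fix P Q :: problem
  assume "P \<in> {P. monodic_problem P}" "Q \<in> {P. monodic_problem P}"
    and eq: "problem_code P = problem_code Q"
  then show "P = Q"
    unfolding problem_code_def monodic_problem_def list_encode_eq
    by (auto simp: set_encode_eq inj_image_eq_iff[OF inj_fm_code]
        inj_image_eq_iff[OF inj_step_code] inj_image_eq_iff[OF inj_eventuality_code]
        intro: problem.equality)
qed


section \<open>Countable domains suffice\<close>

lemma finite_fv: "finite (fv \<phi>)"
proof (induction \<phi>)
  case (Atom p ts)
  have "finite (tm_vars t)" for t by (cases t) auto
  then show ?case by simp
qed auto

lemma tm_val_cong: "(\<forall>x\<in>tm_vars t. a x = b x) \<Longrightarrow> tm_val M a t = tm_val M b t"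
  by (cases t) auto

lemma holds_cong: "(\<forall>x\<in>fv \<phi>. a x = b x) \<Longrightarrow> holds M n a \<phi> \<longleftrightarrow> holds M n b \<phi>"
proof (induction \<phi> arbitrary: n a b)
  case (Atom p ts)
  then have "map (tm_val M a) ts = map (tm_val M b) ts"
    by (auto intro!: tm_val_cong)
  then show ?case by (simp only: holds.simps)
next
  case (Neg \<phi>)
  then show ?case by simp
next
  case (Conj \<phi> \<psi>)
  then have "holds M n a \<phi> \<longleftrightarrow> holds M n b \<phi>" "holds M n a \<psi> \<longleftrightarrow> holds M n b \<psi>"
    by (simp_all add: Conj.IH)
  then show ?case by simp
next
  case (Disj \<phi> \<psi>)
  then have "holds M n a \<phi> \<longleftrightarrow> holds M n b \<phi>" "holds M n a \<psi> \<longleftrightarrow> holds M n b \<psi>"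
    by (simp_all add: Disj.IH)
  then show ?case by simp
next
  case (Imp \<phi> \<psi>)
  then have "holds M n a \<phi> \<longleftrightarrow> holds M n b \<phi>" "holds M n a \<psi> \<longleftrightarrow> holds M n b \<psi>"
    by (simp_all add: Imp.IH)
  then show ?case by simp
next
  case (Iff \<phi> \<psi>)
  then have "holds M n a \<phi> \<longleftrightarrow> holds M n b \<phi>" "holds M n a \<psi> \<longleftrightarrow> holds M n b \<psi>"
    by (simp_all add: Iff.IH)
  then show ?case by simp
next
  case (Forall x \<phi>)
  have "holds M n (a(x := d)) \<phi> \<longleftrightarrow> holds M n (b(x := d)) \<phi>" for d
    using Forall.prems by (intro Forall.IH) auto
  then show ?case by simp
next
  case (Exists x \<phi>)
  have "holds M n (a(x := d)) \<phi> \<longleftrightarrow> holds M n (b(x := d)) \<phi>" for d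
    using Exists.prems by (intro Exists.IH) auto
  then show ?case by simp
next
  case (Next \<phi>)
  then show ?case by simp
next
  case (Sometime \<phi>)
  then have "holds M m a \<phi> \<longleftrightarrow> holds M m b \<phi>" for m by simp
  then show ?case by simp
next
  case (Always \<phi>)
  then have "holds M m a \<phi> \<longleftrightarrow> holds M m b \<phi>" for m by simp
  then show ?case by simp
qed auto

definition witness_closed :: "'d tstruct \<Rightarrow> 'd set \<Rightarrow> bool" where
  "witness_closed M C \<longleftrightarrow> (\<forall>n a x \<phi>. range a \<subseteq> C \<longrightarrow>
     (\<exists>d\<in>domain_of M. holds M n (a(x := d)) \<phi>) \<longrightarrow> (\<exists>d\<in>C. holds M n (a(x := d)) \<phi>))"

lemma countable_witness_closed:
  fixes M :: "'d tstruct"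
  assumes B: "countable B" "B \<noteq> {}" "B \<subseteq> domain_of M"
  obtains C where "countable C" "B \<subseteq> C" "C \<subseteq> domain_of M" "witness_closed M C"
proof -
  obtain d0 where d0: "d0 \<in> B" using B by blast
  define asg where "asg l = (\<lambda>i. if i < length l then l ! i else d0)" for l :: "'d list"
  define w where "w q = (case q of (n, l, x, k) \<Rightarrow>
      (if \<exists>d\<in>domain_of M. holds M n ((asg l)(x := d)) (inv fm_code k)
       then SOME d. d \<in> domain_of M \<and> holds M n ((asg l)(x := d)) (inv fm_code k) else d0))"
    for q :: "nat \<times> 'd list \<times> nat \<times> nat"
  define G where "G A = A \<union> w ` (UNIV \<times> lists A \<times> UNIV \<times> UNIV)" for A
  define C where "C = (\<Union>k. (G ^^ k) B)"
  have w_dom: "w q \<in> domain_of M" for q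
  proof (cases q)
    case (fields n l x k)
    show ?thesis
    proof (cases "\<exists>d\<in>domain_of M. holds M n ((asg l)(x := d)) (inv fm_code k)")
      case True
      then have "\<exists>d. d \<in> domain_of M \<and> holds M n ((asg l)(x := d)) (inv fm_code k)"
        by blast
      from someI_ex[OF this] True show ?thesis by (simp add: w_def fields)
    next
      case False
      then show ?thesis using d0 B by (auto simp: w_def fields)
    qed
  qed
  have cnt: "countable ((G ^^ k) B)" for k
  proof (induction k)
    case (Suc k)
    then show ?case by (auto simp: G_def intro!: countable_image countable_SIGMA)
  qed (use B in simp)
  have sub: "(G ^^ k) B \<subseteq> domain_of M" for k
    by (induction k) (use B w_dom in \<open>auto simp: G_def\<close>)
  have mono: "(G ^^ k) B \<subseteq> (G ^^ m) B" if "k \<le> m" for k m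
    using that by (induction m rule: dec_induct) (auto simp: G_def)
  have fin: "\<exists>k. set l \<subseteq> (G ^^ k) B" if "set l \<subseteq> C" for l
    using that
  proof (induction l)
    case (Cons y l)
    then obtain k m where "set l \<subseteq> (G ^^ k) B" "y \<in> (G ^^ m) B"
      by (auto simp: C_def)
    then have "set (y # l) \<subseteq> (G ^^ max k m) B"
      using mono[of k "max k m"] mono[of m "max k m"] by auto
    then show ?case ..
  qed auto
  have "witness_closed M C"
    unfolding witness_closed_def
  proof (intro allI impI)
    fix n a x \<phi>
    assume a: "range a \<subseteq> C" and ex: "\<exists>d\<in>domain_of M. holds M n (a(x := d)) \<phi>"
    obtain N where N: "\<forall>i\<in>fv \<phi>. i < N"
      using iffD1[OF finite_nat_set_iff_bounded finite_fv[of \<phi>]] ..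
    define l where "l = map a [0..<N]"
    have agree: "holds M n ((asg l)(x := d)) \<phi> \<longleftrightarrow> holds M n (a(x := d)) \<phi>" for d
      by (rule holds_cong) (simp add: asg_def l_def N)
    have "set l \<subseteq> C" using a by (auto simp: l_def)
    then obtain k where k: "set l \<subseteq> (G ^^ k) B" using fin by blast
    define d where "d = w (n, l, x, fm_code \<phi>)"
    have "d \<in> (G ^^ Suc k) B" using k by (auto simp: d_def G_def)
    then have "d \<in> C" unfolding C_def by blast
    moreover have "holds M n (a(x := d)) \<phi>"
    proof -
      have ex': "\<exists>d. d \<in> domain_of M \<and> holds M n ((asg l)(x := d)) \<phi>"
        using ex agree by blast
      have "d = (SOME d. d \<in> domain_of M \<and> holds M n ((asg l)(x := d)) \<phi>)"
        using ex' unfolding d_def w_def by (auto simp: inv_f_f[OF inj_fm_code])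
      with someI_ex[OF ex'] have "holds M n ((asg l)(x := d)) \<phi>" by simp
      then show ?thesis by (simp add: agree)
    qed
    ultimately show "\<exists>d\<in>C. holds M n (a(x := d)) \<phi>" by blast
  qed
  moreover have "countable C" unfolding C_def using cnt by blast
  moreover have "C \<subseteq> domain_of M" unfolding C_def using sub by blast
  moreover have "B \<subseteq> C" unfolding C_def by (rule subsetI, rule UN_I[of 0]) auto
  ultimately show thesis using that by blast
qed

theorem satisfiable_if_holds:
  fixes M :: "'d tstruct"
  assumes M: "temporal_structure M" and a: "range a \<subseteq> domain_of M" and h: "holds M 0 a \<phi>"
  shows "satisfiable \<phi>"
proof -
  obtain C where C: "countable C" "range (const_of M) \<union> range a \<subseteq> C" "C \<subseteq> domain_of M"
    "witness_closed M C"
    using countable_witness_closed[of "range (const_of M) \<union> range a" M] M a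
    by (auto simp: temporal_structure_def)
  define g where "g = from_nat_into C"
  have rg: "range g = C"
    unfolding g_def using C(1,2) by (intro range_from_nat_into) auto
  define e where "e = inv g"
  have ge: "g (e d) = d" if "d \<in> C" for d
    unfolding e_def using that rg by (intro f_inv_into_f) auto
  define N :: "nat tstruct" where "N = \<lparr>domain_of = UNIV, const_of = e \<circ> const_of M,
    pred_of = (\<lambda>n p ds. pred_of M n p (map g ds))\<rparr>"
  have dN: "domain_of N = UNIV" by (simp add: N_def)
  have tv: "g (tm_val N b t) = tm_val M (g \<circ> b) t" for b t
  proof (cases t)
    case (Const c)
    then show ?thesis using C(2) by (auto simp: N_def intro!: ge)
  qed simp
  have upd: "(g \<circ> b)(x := g i) = g \<circ> b(x := i)" for b :: "nat \<Rightarrow> nat" and x i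
    by auto
  have wit: "(\<exists>d\<in>domain_of M. holds M n ((g \<circ> b)(x := d)) \<psi>)
      \<longleftrightarrow> (\<exists>i. holds M n (g \<circ> b(x := i)) \<psi>)" for n b x \<psi>
  proof
    assume "\<exists>d\<in>domain_of M. holds M n ((g \<circ> b)(x := d)) \<psi>"
    moreover have "range (g \<circ> b) \<subseteq> C" using rg by auto
    ultimately obtain d where d: "d \<in> C" "holds M n ((g \<circ> b)(x := d)) \<psi>"
      using C(4) unfolding witness_closed_def by blast
    from d(1) obtain i where "d = g i" using rg by blast
    with d(2) show "\<exists>i. holds M n (g \<circ> b(x := i)) \<psi>" by (metis upd)
  next
    assume "\<exists>i. holds M n (g \<circ> b(x := i)) \<psi>"
    then show "\<exists>d\<in>domain_of M. holds M n ((g \<circ> b)(x := d)) \<psi>"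
      using rg C(3) upd by (metis rangeI subsetD)
  qed
  have eq: "holds N n b \<psi> \<longleftrightarrow> holds M n (g \<circ> b) \<psi>" for n b \<psi>
  proof (induction \<psi> arbitrary: n b)
    case (Atom p ts)
    have m: "map g (map (tm_val N b) ts) = map (tm_val M (g \<circ> b)) ts"
      by (simp add: tv)
    have "pred_of N n p ds = pred_of M n p (map g ds)" for ds
      by (simp add: N_def)
    then show ?case by (simp only: holds.simps m)
  next
    case (Forall x \<psi>)
    show ?case unfolding holds.simps dN Forall.IH
      using wit[of n b x "Neg \<psi>", unfolded holds.simps] by blast
  next
    case (Exists x \<psi>)
    show ?case unfolding holds.simps dN Exists.IH
      using wit[of n b x \<psi>] by blast
  qed auto
  have "g \<circ> (e \<circ> a) = a"
    by (rule ext) (use ge C(2) in \<open>simp add: image_subset_iff\<close>)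
  then have "holds N 0 (e \<circ> a) \<phi>" using h by (simp add: eq)
  moreover have "temporal_structure N" "range (e \<circ> a) \<subseteq> domain_of N"
    by (auto simp: temporal_structure_def N_def)
  ultimately show ?thesis unfolding satisfiable_def by blast
qed

end

theory Submission
  imports Defs
begin

text \<open>The only link between consecutive moments that a grounded problem has are its propositions, so
  the non-ground step clauses \<open>L\<^sub>s(x) \<Rightarrow> \<circle>M\<^sub>s(x)\<close> are replaced by the consequences that closed
  formulae can express: for every set \<open>J\<close> of them,
  \<open>\<exists>x \<And>\<^sub>J L\<^sub>s(x) \<Rightarrow> \<circle>\<exists>x \<And>\<^sub>J M\<^sub>s(x)\<close> and \<open>\<forall>x \<Or>\<^sub>J L\<^sub>s(x) \<Rightarrow> \<circle>\<forall>x \<Or>\<^sub>J M\<^sub>s(x)\<close>, and the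
  same with each occurring constant \<open>c\<close> in place of \<open>x\<close>.  Fresh propositions name the two sides.
  In a model of the result call \<open>d'\<close> at moment \<open>n + 1\<close> a successor of \<open>d\<close> at moment \<open>n\<close> if the pair
  respects all non-ground step clauses.  The first kind of clause gives every element a successor,
  the second gives every element a predecessor, and the constants are their own successors.
  Hence every element at every moment lies on an infinite run, and the runs form the constant
  domain of a model of the given problem.\<close>


section \<open>Closure properties of recursive functions\<close>

text \<open>Curried forms for fixed arities. With closure rules stated for them, a goal
  \<open>recursive n (\<lambda>xs. ...)\<close> can be decomposed along the syntax of its
  body.\<close>

definition recursive1 :: "(nat \<Rightarrow> nat) \<Rightarrow> bool" where
  "recursive1 f \<longleftrightarrow> recursive 1 (\<lambda>xs. f (xs ! 0))"

definition recursive2 :: "(nat \<Rightarrow> nat \<Rightarrow> nat) \<Rightarrow> bool" where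
  "recursive2 f \<longleftrightarrow> recursive 2 (\<lambda>xs. f (xs ! 0) (xs ! 1))"

definition recursive3 :: "(nat \<Rightarrow> nat \<Rightarrow> nat \<Rightarrow> nat) \<Rightarrow> bool" where
  "recursive3 f \<longleftrightarrow> recursive 3 (\<lambda>xs. f (xs ! 0) (xs ! 1) (xs ! 2))"

definition recursive4 :: "(nat \<Rightarrow> nat \<Rightarrow> nat \<Rightarrow> nat \<Rightarrow> nat) \<Rightarrow> bool" where
  "recursive4 f \<longleftrightarrow> recursive 4 (\<lambda>xs. f (xs ! 0) (xs ! 1) (xs ! 2) (xs ! 3))"

definition decidable :: "nat \<Rightarrow> (nat list \<Rightarrow> bool) \<Rightarrow> bool" where
  "decidable n P \<longleftrightarrow> recursive n (\<lambda>xs. of_bool (P xs))"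

lemma recursive_comp1:
  assumes "recursive1 f" "recursive n g"
  shows "recursive n (\<lambda>xs. f (g xs))"
  using rec_comp[of "[g]" "\<lambda>xs. f (xs ! 0)" n] assms by (simp add: recursive1_def)

lemma recursive_comp2:
  assumes "recursive2 f" "recursive n g" "recursive n h"
  shows "recursive n (\<lambda>xs. f (g xs) (h xs))"
  using rec_comp[of "[g, h]" "\<lambda>xs. f (xs ! 0) (xs ! 1)" n] assms
  by (simp add: recursive2_def numeral_eq_Suc)

lemma recursive_comp3:
  assumes "recursive3 f" "recursive n g" "recursive n h" "recursive n k"
  shows "recursive n (\<lambda>xs. f (g xs) (h xs) (k xs))"
  using rec_comp[of "[g, h, k]" "\<lambda>xs. f (xs ! 0) (xs ! 1) (xs ! 2)" n] assms
  by (simp add: recursive3_def numeral_eq_Suc)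

lemma recursive_rec_nat:
  assumes f: "recursive2 f" and g: "recursive4 g"
  shows "recursive3 (\<lambda>m a b. rec_nat (f a b) (\<lambda>k r. g k r a b) m)"
  unfolding recursive3_def
\<comment> \<open>\<open>rec_prim\<close> speaks of \<open>hd\<close> and \<open>tl\<close>, which
  agree with indexing only on lists of length 3; \<open>rec_ext\<close> permits the
  exchange.\<close>
proof (rule rec_ext)
  show "recursive 3 (\<lambda>xs. rec_nat (f (tl xs ! 0) (tl xs ! 1))
      (\<lambda>k r. g ((k # r # tl xs) ! 0) ((k # r # tl xs) ! 1) ((k # r # tl xs) ! 2) ((k # r # tl xs) ! 3))
      (hd xs))"
    using rec_prim[OF f[unfolded recursive2_def], simplified, OF g[unfolded recursive4_def]]
    by simp
qed (auto simp: length_Suc_conv numeral_eq_Suc)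

lemma recursive_Suc: "recursive n f \<Longrightarrow> recursive n (\<lambda>xs. Suc (f xs))"
  using recursive_comp1[of Suc n f] rec_succ by (simp add: recursive1_def)

lemma recursive_const: "recursive n (\<lambda>xs. c)"
  by (induction c) (simp_all add: rec_zero recursive_Suc)

lemma recursive_nth: "i < n \<Longrightarrow> recursive n (\<lambda>xs. xs ! i)"
  by (rule rec_proj)

lemmas recursive_basic = recursive_Suc recursive_const recursive_nth
lemmas recursive_defs = recursive1_def recursive2_def recursive3_def recursive4_def

text \<open>Primitive recursion is set up once, with two parameters. Versions with fewer parameters
  arise by adding dummy arguments and then filling them with 0.\<close>

lemma recursive3_2: "recursive3 (\<lambda>a b c. f a b) \<Longrightarrow> recursive2 f"
  by (drule recursive_comp3[where n = 2 and g = "\<lambda>xs. xs ! 0" and h = "\<lambda>xs. xs ! 1" and k = "\<lambda>xs. 0"])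
    (auto simp: recursive2_def intro!: recursive_basic)

lemma recursive2_1: "recursive2 (\<lambda>a b. f a) \<Longrightarrow> recursive1 f"
  by (drule recursive_comp2[where n = 1 and g = "\<lambda>xs. xs ! 0" and h = "\<lambda>xs. 0"])
    (auto simp: recursive1_def intro!: recursive_basic)

lemma recursive2_rec_nat:
  assumes "recursive1 f" "recursive3 g"
  shows "recursive2 (\<lambda>m a. rec_nat (f a) (\<lambda>k r. g k r a) m)"
  by (rule recursive3_2, rule recursive_rec_nat)
    (auto simp: recursive2_def recursive4_def
      intro!: recursive_comp1[OF assms(1)] recursive_comp3[OF assms(2)] recursive_basic)

text \<open>The second premise lets the recursion be identified with a function given in closed
  form.\<close>

lemma recursive1_rec_nat:
  assumes "recursive2 g" "\<And>m. rec_nat c g m = f m"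
  shows "recursive1 f"
proof -
  have "recursive2 (\<lambda>m a. rec_nat c (\<lambda>k r. g k r) m)"
    by (intro recursive2_rec_nat)
      (auto simp: recursive1_def recursive3_def intro!: recursive_comp2[OF assms(1)] recursive_basic)
  then show ?thesis using recursive2_1 assms(2) by simp
qed

lemma recursive_add: "recursive n f \<Longrightarrow> recursive n g \<Longrightarrow> recursive n (\<lambda>xs. f xs + g xs)"
proof (rule recursive_comp2[of "(+)"])
  have "recursive2 (\<lambda>m a. rec_nat a (\<lambda>k r. Suc r) m)"
    by (intro recursive2_rec_nat) (auto simp: recursive_defs intro!: recursive_basic)
  moreover have "rec_nat a (\<lambda>k r. Suc r) m = m + a" for m a :: nat
    by (induction m) auto
  ultimately show "recursive2 (+)" by simp
qed

lemma recursive_mult: "recursive n f \<Longrightarrow> recursive n g \<Longrightarrow> recursive n (\<lambda>xs. f xs * g xs)"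
proof (rule recursive_comp2[of "(*)"])
  have "recursive2 (\<lambda>m a. rec_nat 0 (\<lambda>k r. r + a) m)"
    by (intro recursive2_rec_nat) (auto simp: recursive_defs intro!: recursive_basic recursive_add)
  moreover have "rec_nat 0 (\<lambda>k r. r + a) m = m * a" for m a :: nat
    by (induction m) auto
  ultimately show "recursive2 (*)" by simp
qed

lemma recursive_pred: "recursive n f \<Longrightarrow> recursive n (\<lambda>xs. f xs - 1)"
proof (rule recursive_comp1[of "\<lambda>m. m - 1"])
  have "rec_nat 0 (\<lambda>k r. k) m = m - 1" for m :: nat
    by (cases m) auto
  then show "recursive1 (\<lambda>m. m - 1)"
    by (intro recursive1_rec_nat[of "\<lambda>k r. k" 0]) (auto simp: recursive_defs intro!: recursive_basic)
qed

lemma recursive_diff: "recursive n f \<Longrightarrow> recursive n g \<Longrightarrow> recursive n (\<lambda>xs. f xs - g xs)"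
\<comment> \<open>The recursion runs over the subtrahend, so the two arguments change
  places.\<close>
proof (rule recursive_comp2[of "\<lambda>m a. a - m" n g f])
  have "recursive2 (\<lambda>m a. rec_nat a (\<lambda>k r. r - 1) m)"
    by (intro recursive2_rec_nat)
      (auto simp: recursive_defs intro!: recursive_basic recursive_pred[unfolded One_nat_def])
  moreover have "rec_nat a (\<lambda>k r. r - 1) m = a - m" for m a :: nat
    by (induction m) auto
  ultimately show "recursive2 (\<lambda>m a. a - m)" by simp
qed

section \<open>Decidable predicates\<close>

lemma decidable_le:
  assumes "recursive n f" "recursive n g"
  shows "decidable n (\<lambda>xs. f xs \<le> g xs)"
proof -
  \<comment> \<open>Subtraction is truncated: the inner difference is 0 exactly when the inequality
    holds, and the outer one exchanges zero and nonzero.\<close>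
  have "of_bool (f xs \<le> g xs) = 1 - (f xs - g xs)" for xs by simp
  then show ?thesis using assms
    by (simp only: decidable_def) (intro recursive_diff recursive_const)
qed

lemma decidable_less: "recursive n f \<Longrightarrow> recursive n g \<Longrightarrow> decidable n (\<lambda>xs. f xs < g xs)"
  unfolding less_eq_Suc_le by (intro decidable_le recursive_Suc)

lemma decidable_not: "decidable n P \<Longrightarrow> decidable n (\<lambda>xs. \<not> P xs)"
proof -
  have "of_bool (\<not> P xs) = 1 - (of_bool (P xs) :: nat)" for xs by simp
  then show "decidable n P \<Longrightarrow> ?thesis"
    by (simp only: decidable_def) (intro recursive_diff recursive_const)
qed

lemma decidable_conj: "decidable n P \<Longrightarrow> decidable n Q \<Longrightarrow> decidable n (\<lambda>xs. P xs \<and> Q xs)"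
  unfolding decidable_def of_bool_conj by (rule recursive_mult)

lemma decidable_disj: 
  assumes "decidable n P" "decidable n Q" shows "decidable n (\<lambda>xs. P xs \<or> Q xs)"
  using decidable_not[OF decidable_conj[OF assms[THEN decidable_not]]] by simp

lemma decidable_imp: 
  assumes "decidable n P" "decidable n Q" shows "decidable n (\<lambda>xs. P xs \<longrightarrow> Q xs)"
  using decidable_not[OF decidable_conj[OF assms(1) decidable_not[OF assms(2)]]] by simp

lemma decidable_eq:
  assumes "recursive n f" "recursive n g"
  shows "decidable n (\<lambda>xs. f xs = g xs)"
  unfolding eq_iff using assms by (intro decidable_conj decidable_le)

lemma recursive_if:
  assumes "decidable n P" "recursive n f" "recursive n g"
  shows "recursive n (\<lambda>xs. if P xs then f xs else g xs)"
proof -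
  have "(if P xs then f xs else g xs) = of_bool (P xs) * f xs + (1 - of_bool (P xs)) * g xs" for xs
    by simp
  then show ?thesis using assms unfolding decidable_def
    by (simp only:) (intro recursive_add recursive_mult recursive_diff recursive_const)
qed

lemmas recursive_arith = recursive_basic recursive_add recursive_mult recursive_diff
  recursive_if decidable_le decidable_less decidable_not decidable_conj decidable_disj decidable_imp decidable_eq

section \<open>Bounded sums and bounded quantifiers\<close>

lemma recursive3_sum:
  assumes "recursive3 f"
  shows "recursive3 (\<lambda>m a b. \<Sum>i<m. f i a b)"
proof -
  have "recursive3 (\<lambda>m a b. rec_nat 0 (\<lambda>k r. r + f k a b) m)"
    by (intro recursive_rec_nat)
      (auto simp: recursive2_def recursive4_def intro!: recursive_arith recursive_comp3[OF assms])
  moreover have "rec_nat 0 (\<lambda>k r. r + f k a b) m = (\<Sum>i<m. f i a b)" for m a b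
    by (induction m) auto
  ultimately show ?thesis by simp
qed

lemma recursive2_sum:
  assumes "recursive2 f"
  shows "recursive2 (\<lambda>m a. \<Sum>i<m. f i a)"
  by (rule recursive3_2, rule recursive3_sum)
    (auto simp: recursive3_def intro!: recursive_comp2[OF assms] recursive_basic)

definition decidable2 :: "(nat \<Rightarrow> nat \<Rightarrow> bool) \<Rightarrow> bool" where
  "decidable2 P \<longleftrightarrow> decidable 2 (\<lambda>xs. P (xs ! 0) (xs ! 1))"

definition decidable3 :: "(nat \<Rightarrow> nat \<Rightarrow> nat \<Rightarrow> bool) \<Rightarrow> bool" where
  "decidable3 P \<longleftrightarrow> decidable 3 (\<lambda>xs. P (xs ! 0) (xs ! 1) (xs ! 2))"

lemma decidable_comp2:
  assumes "decidable2 P" "recursive n f" "recursive n g"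
  shows "decidable n (\<lambda>xs. P (f xs) (g xs))"
  using assms unfolding decidable2_def decidable_def
  by (intro recursive_comp2[of "\<lambda>a b. of_bool (P a b)"]) (simp_all add: recursive2_def)

lemma decidable_comp3:
  assumes "decidable3 P" "recursive n f" "recursive n g" "recursive n h"
  shows "decidable n (\<lambda>xs. P (f xs) (g xs) (h xs))"
  using assms unfolding decidable3_def decidable_def
  by (intro recursive_comp3[of "\<lambda>a b c. of_bool (P a b c)"]) (simp_all add: recursive3_def)

text \<open>The number of counterexamples below the bound is a bounded sum, hence recursive, and it
  is compared with 0.\<close>

lemma decidable_Ball:
  assumes "decidable3 P" "recursive n f" "recursive n g" "recursive n h"
  shows "decidable n (\<lambda>xs. \<forall>i<f xs. P i (g xs) (h xs))"
proof -
  have "recursive3 (\<lambda>m a b. \<Sum>i<m. of_bool (\<not> P i a b))"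
    using decidable_not[OF assms(1)[unfolded decidable3_def]]
    by (intro recursive3_sum) (simp add: recursive3_def decidable_def)
  note recursive_comp3[OF this assms(2-4)]
  from decidable_eq[OF this recursive_const[of _ 0]] show ?thesis
    by (simp add: Ball_def del: sum_of_bool_eq)
qed

lemma decidable_Bex:
  assumes "decidable3 P" "recursive n f" "recursive n g" "recursive n h"
  shows "decidable n (\<lambda>xs. \<exists>i<f xs. P i (g xs) (h xs))"
proof -
  have "decidable3 (\<lambda>i a b. \<not> P i a b)"
    using assms(1) unfolding decidable3_def by (rule decidable_not)
  from decidable_not[OF decidable_Ball[OF this assms(2-4)]] show ?thesis by simp
qed

section \<open>The pairing function and its inverses\<close>

lemma recursive_triangle:
  assumes "recursive n f" shows "recursive n (\<lambda>xs. triangle (f xs))"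
proof (rule recursive_comp1[OF _ assms])
  have "rec_nat 0 (\<lambda>k r. r + Suc k) m = triangle m" for m
    by (induction m) auto
  then show "recursive1 triangle"
    by (rule recursive1_rec_nat[rotated]) (auto simp only: recursive_defs intro!: recursive_arith)
qed

lemma recursive_prod_encode:
  "recursive n f \<Longrightarrow> recursive n g \<Longrightarrow> recursive n (\<lambda>xs. prod_encode (f xs, g xs))"
  unfolding prod_encode_def prod.case by (intro recursive_add recursive_triangle)

definition pfst :: "nat \<Rightarrow> nat" where "pfst n = fst (prod_decode n)"
definition psnd :: "nat \<Rightarrow> nat" where "psnd n = snd (prod_decode n)"

lemma pfst_prod_encode [simp]: "pfst (prod_encode (a, b)) = a"
  and psnd_prod_encode [simp]: "psnd (prod_encode (a, b)) = b"
  by (simp_all add: pfst_def psnd_def)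

lemma prod_encode_pfst_psnd [simp]: "prod_encode (pfst n, psnd n) = n"
  by (simp add: pfst_def psnd_def)

text \<open>The inverse of \<open>triangle\<close> rounded down: the largest \<open>r\<close> with
  \<open>triangle r \<le> n\<close>. It grows by at most one per step, so a primitive recursion
  computes it and unpairing becomes recursive.\<close>

definition diagonal :: "nat \<Rightarrow> nat" where
  "diagonal = rec_nat 0 (\<lambda>n r. if triangle (Suc r) \<le> Suc n then Suc r else r)"

lemma diagonal_bounds: "triangle (diagonal n) \<le> n \<and> n < triangle (Suc (diagonal n))"
  by (induction n) (auto simp: diagonal_def)

lemma triangle_mono: "a \<le> b \<Longrightarrow> triangle a \<le> triangle b"
  by (rule lift_Suc_mono_le[of triangle]) auto

text \<open>The pair of \<open>a\<close> and \<open>b\<close> has code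
  \<open>triangle (a + b) + a\<close>. As \<open>a \<le> a + b\<close>, this lies below
  \<open>triangle (Suc (a + b))\<close>, and \<open>diagonal_bounds\<close> with monotonicity leaves
  only one diagonal.\<close>

lemma diagonal_eq: "diagonal n = pfst n + psnd n"
proof (rule ccontr)
  assume ne: "diagonal n \<noteq> pfst n + psnd n"
  have n: "n = triangle (pfst n + psnd n) + pfst n"
    using prod_encode_pfst_psnd[of n] by (simp add: prod_encode_def)
  from ne consider "Suc (diagonal n) \<le> pfst n + psnd n" | "Suc (pfst n + psnd n) \<le> diagonal n"
    by linarith
  then show False
  proof cases
    case 1
    from triangle_mono[OF this] diagonal_bounds[of n] n show False by linarith
  next
    case 2
    from triangle_mono[OF this] diagonal_bounds[of n] n show False by simp
  qed
qed

lemma pfst_eq: "pfst n = n - triangle (diagonal n)"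
  using prod_encode_pfst_psnd[of n] by (simp add: prod_encode_def diagonal_eq)

lemma psnd_eq: "psnd n = diagonal n - pfst n"
  by (simp add: diagonal_eq)

lemma recursive_diagonal: "recursive1 diagonal"
  by (rule recursive1_rec_nat[rotated], rule diagonal_def[symmetric, THEN fun_cong])
    (auto simp only: recursive_defs intro!: recursive_arith recursive_triangle)

lemma recursive_pfst: "recursive n f \<Longrightarrow> recursive n (\<lambda>xs. pfst (f xs))"
  unfolding pfst_eq
  by (intro recursive_arith recursive_triangle recursive_comp1[OF recursive_diagonal])

lemma recursive_psnd: "recursive n f \<Longrightarrow> recursive n (\<lambda>xs. psnd (f xs))"
  unfolding psnd_eq
  by (intro recursive_arith recursive_pfst recursive_comp1[OF recursive_diagonal])

section \<open>Powers of two and bit sets\<close>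

lemma recursive_exp2:
  assumes "recursive n f" shows "recursive n (\<lambda>xs. 2 ^ f xs)"
proof (rule recursive_comp1[OF _ assms])
  have "rec_nat 1 (\<lambda>k r. r + r) m = (2 :: nat) ^ m" for m
    by (induction m) auto
  then show "recursive1 ((^) 2)"
    by (rule recursive1_rec_nat[rotated]) (auto simp only: recursive_defs intro!: recursive_arith)
qed

lemma recursive_mod2:
  assumes "recursive n f" shows "recursive n (\<lambda>xs. f xs mod 2)"
proof (rule recursive_comp1[OF _ assms])
  have "rec_nat 0 (\<lambda>k r. 1 - r) m = m mod 2" for m :: nat
    by (induction m) (auto simp: mod_Suc)
  then show "recursive1 (\<lambda>m. m mod 2)"
    by (rule recursive1_rec_nat[rotated]) (auto simp only: recursive_defs intro!: recursive_arith)
qed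

lemma recursive_div2:
  assumes "recursive n f" shows "recursive n (\<lambda>xs. f xs div 2)"
proof (rule recursive_comp1[OF _ assms])
  \<comment> \<open>The half grows exactly when the step starts from an odd number.\<close>
  have "rec_nat 0 (\<lambda>k r. r + k mod 2) m = m div 2" for m :: nat
  proof (induction m)
    case (Suc m)
    have "Suc m div 2 = m div 2 + m mod 2" by presburger
    then show ?case using Suc by simp
  qed simp
  then show "recursive1 (\<lambda>m. m div 2)"
    by (rule recursive1_rec_nat[rotated])
      (auto simp only: recursive_defs intro!: recursive_arith recursive_mod2)
qed

text \<open>Membership in a set given by its canonical index is a bit test, and shifting to the
  right is iterated halving.\<close>

lemma decidable_set_decode:
  assumes "recursive n f" "recursive n g"
  shows "decidable n (\<lambda>xs. f xs \<in> set_decode (g xs))"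
proof (rule decidable_comp2[OF _ assms])
  have "recursive2 (\<lambda>m a. rec_nat a (\<lambda>k r. r div 2) m)"
    by (intro recursive2_rec_nat) (auto simp only: recursive_defs intro!: recursive_arith recursive_div2)
  moreover have "rec_nat a (\<lambda>k r. r div 2) m = a div 2 ^ m" for a m :: nat
    by (induction m) (simp_all add: div_mult2_eq[symmetric] mult.commute)
  ultimately have *: "recursive2 (\<lambda>m a. a div 2 ^ m)" by simp
  have "decidable 2 (\<lambda>xs. (xs ! 1) div 2 ^ (xs ! 0) mod 2 = 1)"
    by (intro recursive_arith recursive_mod2 recursive_comp2[OF *]) simp_all
  then show "decidable2 (\<lambda>m a. m \<in> set_decode a)"
    by (simp add: decidable2_def set_decode_def odd_iff_mod_2_eq_one)
qed

lemmas recursive_intros = recursive_arith recursive_triangle recursive_prod_encode recursive_pfst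
  recursive_psnd recursive_exp2 decidable_set_decode


section \<open>The reduct of a problem\<close>

primrec left_lit :: "step_clause \<Rightarrow> lit" where
  "left_lit (GroundStep l m) = l"
| "left_lit (NonGroundStep l m) = l"

primrec right_lit :: "step_clause \<Rightarrow> lit" where
  "right_lit (GroundStep l m) = m"
| "right_lit (NonGroundStep l m) = m"

primrec tm_consts :: "tm \<Rightarrow> nat set" where
  "tm_consts (Var x) = {}"
| "tm_consts (Const c) = {c}"

primrec fm_consts :: "fm \<Rightarrow> nat set" where
  "fm_consts (Atom p ts) = \<Union> (tm_consts ` set ts)"
| "fm_consts Top = {}"
| "fm_consts Bot = {}"
| "fm_consts (Neg \<phi>) = fm_consts \<phi>"
| "fm_consts (Conj \<phi> \<psi>) = fm_consts \<phi> \<union> fm_consts \<psi>"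
| "fm_consts (Disj \<phi> \<psi>) = fm_consts \<phi> \<union> fm_consts \<psi>"
| "fm_consts (Imp \<phi> \<psi>) = fm_consts \<phi> \<union> fm_consts \<psi>"
| "fm_consts (Iff \<phi> \<psi>) = fm_consts \<phi> \<union> fm_consts \<psi>"
| "fm_consts (Forall x \<phi>) = fm_consts \<phi>"
| "fm_consts (Exists x \<phi>) = fm_consts \<phi>"
| "fm_consts (Next \<phi>) = fm_consts \<phi>"
| "fm_consts (Sometime \<phi>) = fm_consts \<phi>"
| "fm_consts (Always \<phi>) = fm_consts \<phi>"

text \<open>Arities are dropped, so a name above all of these is fresh at every arity.\<close>

primrec fm_preds :: "fm \<Rightarrow> nat set" where
  "fm_preds (Atom p ts) = {p}"
| "fm_preds Top = {}"
| "fm_preds Bot = {}"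
| "fm_preds (Neg \<phi>) = fm_preds \<phi>"
| "fm_preds (Conj \<phi> \<psi>) = fm_preds \<phi> \<union> fm_preds \<psi>"
| "fm_preds (Disj \<phi> \<psi>) = fm_preds \<phi> \<union> fm_preds \<psi>"
| "fm_preds (Imp \<phi> \<psi>) = fm_preds \<phi> \<union> fm_preds \<psi>"
| "fm_preds (Iff \<phi> \<psi>) = fm_preds \<phi> \<union> fm_preds \<psi>"
| "fm_preds (Forall x \<phi>) = fm_preds \<phi>"
| "fm_preds (Exists x \<phi>) = fm_preds \<phi>"
| "fm_preds (Next \<phi>) = fm_preds \<phi>"
| "fm_preds (Sometime \<phi>) = fm_preds \<phi>"
| "fm_preds (Always \<phi>) = fm_preds \<phi>"

text \<open>Step and eventuality clauses contain no constants, so these are all constants of the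
  problem.\<close>

definition problem_consts :: "problem \<Rightarrow> nat set" where
  "problem_consts P = \<Union> (fm_consts ` (universal_part P \<union> initial_part P))"

definition nonground_steps :: "problem \<Rightarrow> step_clause set" where
  "nonground_steps P = {s \<in> step_part P. \<not> ground_step s}"

text \<open>The order by code makes the formulae below functions of the set alone, whose codes can
  be recomputed by recursion over clause codes.\<close>

definition listing :: "step_clause set \<Rightarrow> step_clause list" where
  "listing J = map (inv step_code) (sorted_list_of_set (step_code ` J))"

text \<open>The left fold puts the clause with the largest code outermost, which matches a primitive
  recursion running upwards through the codes, as in \<open>lits_code\<close>.\<close>

definition conj_lits :: "(step_clause \<Rightarrow> lit) \<Rightarrow> step_clause set \<Rightarrow> tm \<Rightarrow> fm" where
  "conj_lits side J t = fold (\<lambda>s. Conj (lit_fm (side s) [t])) (listing J) Top"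

definition disj_lits :: "(step_clause \<Rightarrow> lit) \<Rightarrow> step_clause set \<Rightarrow> tm \<Rightarrow> fm" where
  "disj_lits side J t = fold (\<lambda>s. Disj (lit_fm (side s) [t])) (listing J) Bot"

type_synonym index = "bool \<times> step_clause set \<times> tm"

text \<open>For \<open>t = Const c\<close> the quantifier is vacuous, so that constants and quantified variables are
  treated uniformly.\<close>

primrec index_fm :: "(step_clause \<Rightarrow> lit) \<Rightarrow> index \<Rightarrow> fm" where
  "index_fm side (b, J_t) = (if b then Exists 0 (conj_lits side (fst J_t) (snd J_t))
     else Forall 0 (disj_lits side (fst J_t) (snd J_t)))"

text \<open>Injective only on triples with finite clause sets, because canonical indices are; hence
  the restriction to \<open>indices P\<close> later.\<close>

primrec index_code :: "index \<Rightarrow> nat" where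
  "index_code (b, J_t) =
     prod_encode (of_bool b, prod_encode (set_encode (step_code ` fst J_t), tm_code (snd J_t)))"

text \<open>Left names lie at odd offsets from \<open>N\<close> and right names at positive even
  ones, so the two kinds never meet and all of them exceed \<open>N\<close>.\<close>

definition left_name :: "nat \<Rightarrow> index \<Rightarrow> nat" where
  "left_name N i = N + 2 * index_code i + 1"

definition right_name :: "nat \<Rightarrow> index \<Rightarrow> nat" where
  "right_name N i = N + 2 * index_code i + 2"

text \<open>Each name gets one implication, in the direction in which truth travels: from the left
  formula to its name, by \<open>index_step\<close> to the right name one moment later, and from
  there to the right formula.\<close>

definition index_axiom :: "nat \<Rightarrow> index \<Rightarrow> fm" where
  "index_axiom N i = Conj (Imp (index_fm left_lit i) (Atom (left_name N i) []))
     (Imp (Atom (right_name N i) []) (index_fm right_lit i))"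

definition index_step :: "nat \<Rightarrow> index \<Rightarrow> step_clause" where
  "index_step N i = GroundStep (Pos (left_name N i)) (Pos (right_name N i))"

definition indices :: "problem \<Rightarrow> index set" where
  "indices P = UNIV \<times> Pow (nonground_steps P) \<times> insert (Var 0) (Const ` problem_consts P)"

text \<open>The code of a problem exceeds all predicate names in it, so names above it are fresh.\<close>

definition reduct :: "problem \<Rightarrow> problem" where
  "reduct P = \<lparr>
     universal_part = universal_part P \<union> index_axiom (problem_code P) ` indices P,
     initial_part = initial_part P,
     step_part = {s \<in> step_part P. ground_step s} \<union> index_step (problem_code P) ` indices P,
     eventuality_part = eventuality_part P\<rparr>"


section \<open>Codes bound names\<close>

text \<open>The element \<open>n\<close> contributes \<open>2 ^ n\<close> to the sum, and this alone
  exceeds \<open>n\<close>.\<close>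

lemma less_set_encode: "finite A \<Longrightarrow> n \<in> A \<Longrightarrow> n < set_encode A"
  unfolding set_encode_def by (rule less_le_trans[OF less_exp], rule member_le_sum) auto

lemma set_decode_less: "n \<in> set_decode a \<Longrightarrow> n < a"
  using less_set_encode[of "set_decode a" n] by simp

lemma prod_encode_bounds: "a \<le> prod_encode (a, b)" "b \<le> prod_encode (a, b)"
  by (rule le_prod_encode_1, rule le_prod_encode_2)

lemma fm_preds_le: "p \<in> fm_preds \<phi> \<Longrightarrow> p \<le> fm_code \<phi>"
proof (induction \<phi>)
  case (Atom q ts)
  then show ?case by (auto intro: order_trans[OF prod_encode_bounds(1)] prod_encode_bounds(2))
qed (auto intro: order_trans[OF _ prod_encode_bounds(2)] order_trans[OF _ prod_encode_bounds(1)])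

lemma problem_code_eq:
  "problem_code P = Suc (prod_encode (set_encode (fm_code ` universal_part P),
     Suc (prod_encode (set_encode (fm_code ` initial_part P),
     Suc (prod_encode (set_encode (step_code ` step_part P),
     Suc (prod_encode (set_encode (eventuality_code ` eventuality_part P), 0))))))))"
  by (simp add: problem_code_def)

lemma part_less_problem_code:
  "set_encode (fm_code ` universal_part P) < problem_code P"
  "set_encode (fm_code ` initial_part P) < problem_code P"
  "set_encode (step_code ` step_part P) < problem_code P"
  "set_encode (eventuality_code ` eventuality_part P) < problem_code P"
  unfolding problem_code_eq less_Suc_eq_le
  by (rule prod_encode_bounds order_trans[OF _ prod_encode_bounds(2)] le_SucI)+

text \<open>Together with the bounds of names by codes, this makes every name from
  \<open>problem_code P\<close> upwards fresh.\<close>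

lemma member_less_problem_code:
  assumes "monodic_problem P"
  shows "\<phi> \<in> universal_part P \<union> initial_part P \<Longrightarrow> fm_code \<phi> < problem_code P"
    "s \<in> step_part P \<Longrightarrow> step_code s < problem_code P"
    "e \<in> eventuality_part P \<Longrightarrow> eventuality_code e < problem_code P"
  using assms part_less_problem_code[of P]
    less_set_encode[of "fm_code ` universal_part P" "fm_code \<phi>"]
    less_set_encode[of "fm_code ` initial_part P" "fm_code \<phi>"]
    less_set_encode[of "step_code ` step_part P" "step_code s"]
    less_set_encode[of "eventuality_code ` eventuality_part P" "eventuality_code e"]
  by (auto simp: monodic_problem_def)

primrec lit_name :: "lit \<Rightarrow> nat" where
  "lit_name (Pos p) = p"
| "lit_name (Negative p) = p"

primrec ev_lit :: "eventuality \<Rightarrow> lit" where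
  "ev_lit (GroundEv l) = l"
| "ev_lit (NonGroundEv l) = l"

lemma lit_name_le: "lit_name l \<le> lit_code l"
  by (cases l) (simp_all add: prod_encode_bounds)

lemma left_lit_name_le: "lit_name (left_lit s) \<le> step_code s"
  by (cases s) (simp_all, (meson lit_name_le prod_encode_bounds order_trans)+)

lemma right_lit_name_le: "lit_name (right_lit s) \<le> step_code s"
  by (cases s) (simp_all, (meson lit_name_le prod_encode_bounds order_trans)+)

lemma ev_lit_name_le: "lit_name (ev_lit e) \<le> eventuality_code e"
  by (cases e) (simp_all, (meson lit_name_le prod_encode_bounds order_trans)+)


section \<open>Semantics of problems\<close>

definition lit_holds :: "'d tstruct \<Rightarrow> nat \<Rightarrow> lit \<Rightarrow> 'd list \<Rightarrow> bool" where
  "lit_holds M n l ds = (case l of Pos p \<Rightarrow> pred_of M n p ds | Negative p \<Rightarrow> \<not> pred_of M n p ds)"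

lemma holds_lit_fm: "holds M n a (lit_fm l ts) \<longleftrightarrow> lit_holds M n l (map (tm_val M a) ts)"
  by (cases l) (simp_all add: lit_holds_def)

text \<open>The list \<open>ds\<close> is \<open>[]\<close> for a ground clause and
  \<open>[d]\<close> for a non-ground clause at the element \<open>d\<close>, so one definition
  covers both kinds.\<close>

definition step_holds :: "'d tstruct \<Rightarrow> nat \<Rightarrow> step_clause \<Rightarrow> 'd list \<Rightarrow> bool" where
  "step_holds M n s ds \<longleftrightarrow>
     (lit_holds M n (left_lit s) ds \<longrightarrow> lit_holds M (Suc n) (right_lit s) ds)"

definition ev_holds :: "'d tstruct \<Rightarrow> nat \<Rightarrow> eventuality \<Rightarrow> 'd list \<Rightarrow> bool" where
  "ev_holds M n e ds \<longleftrightarrow> (\<exists>m\<ge>n. lit_holds M m (ev_lit e) ds)"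

lemma holds_step_fm:
  "holds M n a (step_fm s) \<longleftrightarrow> step_holds M n s (if ground_step s then [] else [a 0])"
  by (cases s) (simp_all add: step_fm_def step_holds_def holds_lit_fm)

lemma holds_eventuality_fm:
  "holds M n a (eventuality_fm e) \<longleftrightarrow> ev_holds M n e (if ground_ev e then [] else [a 0])"
  by (cases e) (simp_all add: ev_holds_def holds_lit_fm)

text \<open>\<open>problem_fm\<close> puts ground clauses under the quantifier too. For them
  \<open>d\<close> is vacuous, and extracting their truth takes an element of the domain.\<close>

lemma holds_problem_fm:
  assumes "monodic_problem P"
  shows "holds M 0 a (problem_fm P) \<longleftrightarrow>
    (\<forall>\<phi>\<in>initial_part P. holds M 0 a \<phi>) \<and> (\<forall>n. \<forall>\<phi>\<in>universal_part P. holds M n a \<phi>) \<and>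
    (\<forall>n. \<forall>d\<in>domain_of M. \<forall>s\<in>step_part P. step_holds M n s (if ground_step s then [] else [d])) \<and>
    (\<forall>n. \<forall>d\<in>domain_of M. \<forall>e\<in>eventuality_part P. ev_holds M n e (if ground_ev e then [] else [d]))"
  using assms by (simp add: problem_fm_def monodic_problem_def holds_big_conj
      holds_step_fm holds_eventuality_fm)

lemma set_listing: "finite J \<Longrightarrow> set (listing J) = J"
  by (simp add: listing_def image_image inv_f_f[OF inj_step_code])

lemma length_listing: "length (listing J) = card J"
  by (simp add: listing_def card_image inj_on_subset[OF inj_step_code])

lemma holds_conj_lits:
  assumes "finite J"
  shows "holds M n a (conj_lits side J t) \<longleftrightarrow> (\<forall>s\<in>J. lit_holds M n (side s) [tm_val M a t])"
proof -
  have "holds M n a (fold (\<lambda>s. Conj (lit_fm (side s) [t])) xs \<phi>) \<longleftrightarrow>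
      (\<forall>s\<in>set xs. lit_holds M n (side s) [tm_val M a t]) \<and> holds M n a \<phi>" for xs \<phi>
    by (induction xs arbitrary: \<phi>) (auto simp: holds_lit_fm)
  then show ?thesis by (simp add: conj_lits_def set_listing assms)
qed

lemma holds_disj_lits:
  assumes "finite J"
  shows "holds M n a (disj_lits side J t) \<longleftrightarrow> (\<exists>s\<in>J. lit_holds M n (side s) [tm_val M a t])"
proof -
  have "holds M n a (fold (\<lambda>s. Disj (lit_fm (side s) [t])) xs \<phi>) \<longleftrightarrow>
      (\<exists>s\<in>set xs. lit_holds M n (side s) [tm_val M a t]) \<or> holds M n a \<phi>" for xs \<phi>
    by (induction xs arbitrary: \<phi>) (auto simp: holds_lit_fm)
  then show ?thesis by (simp add: disj_lits_def set_listing assms)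
qed

lemma holds_index_fm:
  assumes "finite J"
  shows "holds M n a (index_fm side (b, J, t)) \<longleftrightarrow>
    (if b then \<exists>d\<in>domain_of M. \<forall>s\<in>J. lit_holds M n (side s) [tm_val M (a(0 := d)) t]
     else \<forall>d\<in>domain_of M. \<exists>s\<in>J. lit_holds M n (side s) [tm_val M (a(0 := d)) t])"
  by (simp add: holds_conj_lits holds_disj_lits assms)

text \<open>Permits reinterpreting the fresh propositions without affecting the formulae of the
  given problem.\<close>

lemma holds_preds_cong:
  assumes "domain_of M' = domain_of M" "const_of M' = const_of M"
    "\<And>n p ds. p \<in> fm_preds \<phi> \<Longrightarrow> pred_of M' n p ds = pred_of M n p ds"
  shows "holds M' n a \<phi> \<longleftrightarrow> holds M n a \<phi>"
proof -
  have tv: "tm_val M' a t = tm_val M a t" for a t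
    by (cases t) (simp_all add: assms(2))
  then have "map (tm_val M' a) ts = map (tm_val M a) ts" for a ts by simp
  with assms(3) show ?thesis
  proof (induction \<phi> arbitrary: n a)
    case (Atom p ts)
    then show ?case by (simp only: holds.simps fm_preds.simps) simp
  qed (simp_all add: assms(1))
qed


section \<open>The reduct is grounded\<close>

lemma finite_fm_consts: "finite (fm_consts \<phi>)"
proof (induction \<phi>)
  case (Atom p ts)
  have "finite (tm_consts t)" for t by (cases t) auto
  then show ?case by simp
qed auto

lemma card_fm_consts: "card (fm_consts \<phi>) \<le> fm_size \<phi>"
proof (induction \<phi>)
  case (Atom p ts)
  have "card (\<Union> (tm_consts ` set ts)) \<le> length ts"
  proof (induction ts)
    case (Cons t ts)
    then show ?case using card_Un_le[of "tm_consts t" "\<Union> (tm_consts ` set ts)"]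
      by (cases t) auto
  qed simp
  then show ?case by simp
qed (auto intro: order_trans[OF card_Un_le] add_mono le_SucI)

lemma finite_problem_consts: "monodic_problem P \<Longrightarrow> finite (problem_consts P)"
  by (auto simp: problem_consts_def monodic_problem_def finite_fm_consts)

lemma finite_nonground_steps: "monodic_problem P \<Longrightarrow> finite (nonground_steps P)"
  by (auto simp: nonground_steps_def monodic_problem_def)

lemma finite_indices: "monodic_problem P \<Longrightarrow> finite (indices P)"
  by (simp add: indices_def finite_problem_consts finite_nonground_steps)

lemma finite_index_set: "monodic_problem P \<Longrightarrow> (b, J, t) \<in> indices P \<Longrightarrow> finite J"
  by (auto simp: indices_def intro: finite_subset finite_nonground_steps)

lemma inj_on_index_code: "monodic_problem P \<Longrightarrow> inj_on index_code (indices P)"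
proof (rule inj_onI)
  fix i j assume P: "monodic_problem P" and i: "i \<in> indices P" and j: "j \<in> indices P"
    and eq: "index_code i = index_code j"
  obtain b J t b' J' t' where [simp]: "i = (b, J, t)" "j = (b', J', t')"
    by (metis surj_pair)
  have "finite J" "finite J'" using i j finite_index_set[OF P] by auto
  with eq show "i = j"
    by (simp add: set_encode_eq inj_image_eq_iff[OF inj_step_code] tm_code_eq_iff of_bool_eq_iff)
qed

lemma name_eq_iff:
  "left_name N i = left_name N j \<longleftrightarrow> index_code i = index_code j"
  "right_name N i = right_name N j \<longleftrightarrow> index_code i = index_code j"
  "left_name N i \<noteq> right_name N j"
  unfolding left_name_def right_name_def by (simp, simp) presburger

lemma name_greater: "left_name N i > N" "right_name N i > N"
  by (simp_all add: left_name_def right_name_def)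

text \<open>The names inside tell the axioms apart. Injectivity is what turns sizes and codes of
  images into sums over indices.\<close>

lemma inj_on_index_axiom: "monodic_problem P \<Longrightarrow> inj_on (index_axiom N) (indices P)"
  using inj_on_index_code[of P] by (auto simp: inj_on_def index_axiom_def name_eq_iff)

lemma inj_on_index_step: "monodic_problem P \<Longrightarrow> inj_on (index_step N) (indices P)"
  using inj_on_index_code[of P] by (auto simp: inj_on_def index_step_def name_eq_iff)

text \<open>A member of the universal part has a code below \<open>problem_code P\<close>, whereas
  the axiom contains a name above it.\<close>

lemma index_axiom_notin:
  assumes "monodic_problem P"
  shows "index_axiom (problem_code P) i \<notin> universal_part P"
proof
  assume "index_axiom (problem_code P) i \<in> universal_part P"
  then have "fm_code (index_axiom (problem_code P) i) < problem_code P"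
    using member_less_problem_code[OF assms] by blast
  moreover have "left_name (problem_code P) i \<le> fm_code (index_axiom (problem_code P) i)"
    by (rule fm_preds_le) (simp add: index_axiom_def)
  ultimately show False using name_greater(1)[of "problem_code P" i] by linarith
qed

lemma lit_name_less_problem_code:
  assumes "monodic_problem P" "s \<in> step_part P"
  shows "lit_name (left_lit s) < problem_code P" "lit_name (right_lit s) < problem_code P"
  using member_less_problem_code(2)[OF assms] left_lit_name_le[of s] right_lit_name_le[of s]
  by linarith+

lemma index_step_notin:
  assumes "monodic_problem P"
  shows "index_step (problem_code P) i \<notin> step_part P"
  using lit_name_less_problem_code(1)[OF assms, of "index_step (problem_code P) i"]
    name_greater(1)[of "problem_code P" i]
  by (auto simp: index_step_def)

lemma index_fm_closed:
  assumes "t = Var 0 \<or> t = Const c"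
  shows "fv (index_fm side (b, J, t)) = {}" "first_order (index_fm side (b, J, t))"
proof -
  have lit: "fv (lit_fm l [t]) \<subseteq> {0} \<and> first_order (lit_fm l [t])" for l
    using assms by (cases l) auto
  have "fv \<phi> \<subseteq> {0} \<and> first_order \<phi> \<Longrightarrow>
      fv (fold (\<lambda>s. Conj (lit_fm (side s) [t])) xs \<phi>) \<subseteq> {0} \<and>
      first_order (fold (\<lambda>s. Conj (lit_fm (side s) [t])) xs \<phi>)" for xs \<phi>
    using lit by (induction xs arbitrary: \<phi>) auto
  moreover have "fv \<phi> \<subseteq> {0} \<and> first_order \<phi> \<Longrightarrow>
      fv (fold (\<lambda>s. Disj (lit_fm (side s) [t])) xs \<phi>) \<subseteq> {0} \<and>
      first_order (fold (\<lambda>s. Disj (lit_fm (side s) [t])) xs \<phi>)" for xs \<phi>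
    using lit by (induction xs arbitrary: \<phi>) auto
  ultimately show "fv (index_fm side (b, J, t)) = {}" "first_order (index_fm side (b, J, t))"
    by (simp_all add: conj_lits_def disj_lits_def)
qed

lemma index_axiom_closed:
  assumes "i \<in> indices P"
  shows "fv (index_axiom N i) = {} \<and> first_order (index_axiom N i)"
proof -
  obtain b J t where i: "i = (b, J, t)" by (metis surj_pair)
  with assms obtain c where "t = Var 0 \<or> t = Const c" by (auto simp: indices_def)
  from index_fm_closed[OF this, of _ b J] show ?thesis
    unfolding index_axiom_def i by simp
qed

lemma step_lhs_eq:
  "step_lhs s = step_lhs t \<longleftrightarrow> left_lit s = left_lit t \<and> ground_step s = ground_step t"
proof -
  have "lit_fm l ts = lit_fm l' ts' \<longleftrightarrow> l = l' \<and> ts = ts'" for l l' ts ts'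
    by (cases l; cases l') auto
  then show ?thesis by (cases s; cases t) auto
qed

text \<open>The delicate condition is that left-hand sides stay distinct: old literals have names
  below \<open>problem_code P\<close>, new ones above it.\<close>

lemma grounded_reduct:
  assumes "ground_eventuality_problem P"
  shows "grounded_problem (reduct P)"
proof -
  let ?N = "problem_code P"
  have P: "monodic_problem P" using assms by (simp add: ground_eventuality_problem_def)
  have new: "step_lhs s \<noteq> step_lhs (index_step ?N i)" if "s \<in> step_part P" for s i
    using lit_name_less_problem_code(1)[OF P that] name_greater(1)[of ?N i]
    by (auto simp: index_step_def step_lhs_eq simp del: step_lhs.simps)
  have old: "step_lhs s \<noteq> step_lhs t" if "s \<in> step_part P" "t \<in> step_part P" "s \<noteq> t" for s t
    using P that by (auto simp: monodic_problem_def)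
  \<comment> \<open>Two new clauses with the same left name have equal index codes, hence the same
    right name, and so coincide.\<close>
  have "step_lhs s \<noteq> step_lhs t"
    if "s \<in> step_part (reduct P)" "t \<in> step_part (reduct P)" "s \<noteq> t" for s t
    using that new new[THEN not_sym] old
    by (auto simp: reduct_def) (auto simp: index_step_def name_eq_iff left_name_def right_name_def)
  then show ?thesis
    using assms P index_axiom_closed[of _ P ?N] finite_indices[OF P]
    by (auto simp: grounded_problem_def monodic_problem_def ground_eventuality_problem_def
        reduct_def index_step_def)
qed


section \<open>Satisfiability\<close>

lemma monodic_reduct: "ground_eventuality_problem P \<Longrightarrow> monodic_problem (reduct P)"
  using grounded_reduct by (simp add: grounded_problem_def)

section \<open>From models of the problem to models of the reduct\<close>

text \<open>Domain and constants are kept, and each fresh proposition is interpreted as the formula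
  that it names. The new step clauses hold because the original ones carry the left literals of each
  single element to its right literals.\<close>

lemma satisfiable_reduct:
  assumes P: "ground_eventuality_problem P" and sat: "satisfiable (problem_fm P)"
  shows "satisfiable (problem_fm (reduct P))"
proof -
  have mP: "monodic_problem P" using P by (simp add: ground_eventuality_problem_def)
  obtain M :: "nat tstruct" and a where M: "temporal_structure M" "range a \<subseteq> domain_of M"
    and "holds M 0 a (problem_fm P)"
    using sat by (auto simp: satisfiable_def)
  then have init: "\<And>\<phi>. \<phi> \<in> initial_part P \<Longrightarrow> holds M 0 a \<phi>"
    and univ: "\<And>n \<phi>. \<phi> \<in> universal_part P \<Longrightarrow> holds M n a \<phi>"
    and step: "\<And>n d s. d \<in> domain_of M \<Longrightarrow> s \<in> step_part P \<Longrightarrow>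
        step_holds M n s (if ground_step s then [] else [d])"
    and ev: "\<And>n d e. d \<in> domain_of M \<Longrightarrow> e \<in> eventuality_part P \<Longrightarrow>
        ev_holds M n e (if ground_ev e then [] else [d])"
    unfolding holds_problem_fm[OF mP] by blast+
  define N where "N = problem_code P"
  \<comment> \<open>Only propositions above \<open>N\<close> change; unary literals therefore keep
    their meaning whatever their names, which is \<open>unary_lit\<close>.\<close>
  define M' where "M' = M\<lparr>pred_of := \<lambda>n p ds. if ds = [] \<and> p > N
      then (\<exists>i\<in>indices P. p = left_name N i \<and> holds M n a (index_fm left_lit i) \<or>
             p = right_name N i \<and> holds M n a (index_fm right_lit i))
      else pred_of M n p ds\<rparr>"
  have dom: "domain_of M' = domain_of M" and const: "const_of M' = const_of M"
    by (simp_all add: M'_def)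
  have tv: "tm_val M' b t = tm_val M b t" for b t
    by (cases t) (simp_all add: const)
  have old: "pred_of M' n p ds = pred_of M n p ds" if "p \<le> N" for n p ds
    using that by (simp add: M'_def)
  have old_fm: "holds M' n a \<phi> = holds M n a \<phi>" if "\<phi> \<in> universal_part P \<union> initial_part P" for n \<phi>
  proof (rule holds_preds_cong[OF dom const])
    fix n p ds assume "p \<in> fm_preds \<phi>"
    then show "pred_of M' n p ds = pred_of M n p ds"
      using member_less_problem_code(1)[OF mP that] fm_preds_le[of p \<phi>] old[of p] N_def by simp
  qed
  have old_lit: "lit_holds M' n l ds = lit_holds M n l ds" if "lit_name l \<le> N" for n l ds
    using old that by (cases l) (simp_all add: lit_holds_def)
  have unary_lit: "lit_holds M' n l [d] = lit_holds M n l [d]" for n l d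
    by (cases l) (simp_all add: lit_holds_def M'_def)
  have new_fm: "holds M' n a (index_fm side i) = holds M n a (index_fm side i)"
    if "i \<in> indices P" for n side i
  proof -
    obtain b J t where i: "i = (b, J, t)" by (metis surj_pair)
    have "finite J" using that i finite_index_set[OF mP] by blast
    then show ?thesis unfolding i by (simp only: holds_index_fm tv dom unary_lit)
  qed
  have index_eq: "i = j" if "index_code i = index_code j" "i \<in> indices P" "j \<in> indices P" for i j
    using inj_on_index_code[OF mP] that by (auto simp: inj_on_def)
  have left: "pred_of M' n (left_name N i) [] \<longleftrightarrow> holds M n a (index_fm left_lit i)"
    if "i \<in> indices P" for n i
    using that index_eq name_greater(1)[of N i]
    by (simp add: M'_def name_eq_iff del: index_fm.simps) metis
  have right: "pred_of M' n (right_name N i) [] \<longleftrightarrow> holds M n a (index_fm right_lit i)"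
    if "i \<in> indices P" for n i
    using that index_eq name_greater(2)[of N i]
    by (simp add: M'_def name_eq_iff name_eq_iff(3)[THEN not_sym] del: index_fm.simps) metis
  have axiom: "holds M' n a (index_axiom N i)" if "i \<in> indices P" for n i
    using that by (simp add: index_axiom_def left right new_fm del: index_fm.simps)
  have "holds M (Suc n) a (index_fm right_lit i)"
    if i: "i \<in> indices P" and h: "holds M n a (index_fm left_lit i)" for n i
  proof -
    obtain b J t where i_eq: "i = (b, J, t)" by (metis surj_pair)
    have fin: "finite J" and J: "J \<subseteq> nonground_steps P"
      using i i_eq finite_index_set[OF mP] by (auto simp: indices_def)
    have val: "tm_val M (a(0 := d)) t \<in> domain_of M" if "d \<in> domain_of M" for d
      using that M by (cases t) (auto simp: temporal_structure_def)
    have st: "lit_holds M n (left_lit s) [d] \<Longrightarrow> lit_holds M (Suc n) (right_lit s) [d]"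
      if "s \<in> J" "d \<in> domain_of M" for s d
      using step[of d s n] that J by (auto simp: step_holds_def nonground_steps_def)
    show ?thesis
    \<comment> \<open>Elements persist from one moment to the next, so the same witness, or for each
      element the same member of \<open>J\<close>, serves again by \<open>st\<close>.\<close>
    proof (cases b)
      case True
      with h obtain d where "d \<in> domain_of M"
          "\<forall>s\<in>J. lit_holds M n (left_lit s) [tm_val M (a(0 := d)) t]"
        unfolding i_eq holds_index_fm[OF fin] by auto
      with True show ?thesis unfolding i_eq holds_index_fm[OF fin] using st val by (simp, blast)
    next
      case False
      with h have "\<forall>d\<in>domain_of M. \<exists>s\<in>J. lit_holds M n (left_lit s) [tm_val M (a(0 := d)) t]"
        unfolding i_eq holds_index_fm[OF fin] by simp
      with False show ?thesis unfolding i_eq holds_index_fm[OF fin] using st val by (simp, blast)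
    qed
  qed
  then have new_step: "step_holds M' n (index_step N i) []" if "i \<in> indices P" for n i
    using that by (simp add: index_step_def step_holds_def lit_holds_def left right)
  have old_step: "step_holds M' n s []" if "s \<in> step_part P" "ground_step s" "d \<in> domain_of M" for n s d
    using step[of d s n] that lit_name_less_problem_code[OF mP that(1)]
    by (simp add: step_holds_def old_lit N_def)
  have new_ev: "ev_holds M' n e []" if "e \<in> eventuality_part P" "d \<in> domain_of M" for n e d
  proof -
    have "ground_ev e" using that P by (simp add: ground_eventuality_problem_def)
    with ev[OF that(2,1), of n] member_less_problem_code(3)[OF mP that(1)] ev_lit_name_le[of e]
    show ?thesis by (simp add: ev_holds_def old_lit N_def)
  qed
  have gr: "ground_step s" if "s \<in> step_part (reduct P)" for s
    using grounded_reduct[OF P] that by (simp add: grounded_problem_def)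
  have ge: "ground_ev e" if "e \<in> eventuality_part P" for e
    using P that by (simp add: ground_eventuality_problem_def)
  have "holds M' 0 a (problem_fm (reduct P))"
    unfolding holds_problem_fm[OF monodic_reduct[OF P]]
    using gr ge old_step new_step new_ev axiom init univ
    by (auto simp: reduct_def old_fm dom simp flip: N_def)
  moreover have "temporal_structure M'" "range a \<subseteq> domain_of M'"
    using M by (simp_all add: temporal_structure_def dom const)
  ultimately show ?thesis unfolding satisfiable_def by blast
qed


section \<open>From models of the reduct to models of the problem\<close>

text \<open>Forwards, \<open>total\<close> and dependent choice extend the sequence. Backwards,
  \<open>onto\<close> supplies predecessors, by induction on \<open>n\<close> with the relation
  shifted by one moment.\<close>

lemma run_through:
  assumes total: "\<And>n d. d \<in> D \<Longrightarrow> \<exists>d'\<in>D. R n d d'"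
    and onto: "\<And>n d'. d' \<in> D \<Longrightarrow> \<exists>d\<in>D. R n d d'"
    and d: "d \<in> D"
  obtains r where "r n = d" "\<And>m. r m \<in> D" "\<And>m. R m (r m) (r (Suc m))"
proof -
  have "\<exists>r. r n = d \<and> (\<forall>m. r m \<in> D \<and> R m (r m) (r (Suc m)))"
    using total onto
  proof (induction n arbitrary: R)
    case 0
    \<comment> \<open>The condition at \<open>m = 0\<close> fixes the starting point within
      dependent choice.\<close>
    have "\<exists>r. \<forall>m. (r m \<in> D \<and> (m = 0 \<longrightarrow> r m = d)) \<and> R m (r m) (r (Suc m))"
      by (rule dependent_nat_choice) (use 0(1) d in auto)
    then show ?case by blast
  next
    case (Suc n)
    \<comment> \<open>A run for the shifted relation through \<open>d\<close> at moment
      \<open>n\<close> passes through \<open>d\<close> at \<open>Suc n\<close> once a predecessor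
      \<open>d0\<close> of its first element is put in front.\<close>
    from Suc.IH[of "\<lambda>m. R (Suc m)"] Suc.prems
    obtain r where r: "r n = d" "\<And>m. r m \<in> D" "\<And>m. R (Suc m) (r m) (r (Suc m))" by blast
    obtain d0 where d0: "d0 \<in> D" "R 0 d0 (r 0)" using Suc.prems(2) r(2) by blast
    have "case_nat d0 r m \<in> D \<and> R m (case_nat d0 r m) (case_nat d0 r (Suc m))" for m
      using r d0 by (cases m) auto
    then show ?case using r(1) by (intro exI[of _ "case_nat d0 r"]) simp
  qed
  then show ?thesis using that by blast
qed

text \<open>The domain of the new structure consists of the runs, that is the sequences of elements that
  respect all step clauses.  Every element occurs on a run at every moment, so in the absence of
  equality the projection of the runs to their \<open>n\<close>-th elements preserves all first-order
  formulae.\<close>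

lemma satisfiable_if_satisfiable_reduct:
  assumes P: "ground_eventuality_problem P" and sat: "satisfiable (problem_fm (reduct P))"
  shows "satisfiable (problem_fm P)"
proof -
  have mP: "monodic_problem P" using P by (simp add: ground_eventuality_problem_def)
  obtain M :: "nat tstruct" and a where M: "temporal_structure M" "range a \<subseteq> domain_of M"
    and H: "holds M 0 a (problem_fm (reduct P))"
    using sat by (auto simp: satisfiable_def)
  define N where "N = problem_code P"
  \<comment> \<open>Instantiates the vacuous quantifiers over ground clauses and in index formulae
    at constants, and starts the default run \<open>r0\<close>.\<close>
  obtain e0 where e0: "e0 \<in> domain_of M" using M by (auto simp: temporal_structure_def)
  note H' = H[unfolded holds_problem_fm[OF monodic_reduct[OF P]]]
  from H' have init: "holds M 0 a \<phi>" if "\<phi> \<in> initial_part P" for \<phi>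
    using that by (simp add: reduct_def)
  from H' have univ: "holds M n a \<phi>" if "\<phi> \<in> universal_part P" for n \<phi>
    using that by (simp add: reduct_def)
  from H' have axiom: "holds M n a (index_axiom N i)" if "i \<in> indices P" for n i
    using that by (simp add: reduct_def N_def)
  have steps: "step_holds M n s []" if "s \<in> step_part (reduct P)" "ground_step s" for n s
    using H'[THEN conjunct2, THEN conjunct2, THEN conjunct1, rule_format, OF e0, of s n] that
    by simp
  have step: "step_holds M n s []" if "s \<in> step_part P" "ground_step s" for n s
    using steps that by (simp add: reduct_def)
  have index_step: "step_holds M n (index_step N i) []" if "i \<in> indices P" for n i
    using steps that by (simp add: reduct_def N_def index_step_def)
  have ev: "ev_holds M n e []" if "e \<in> eventuality_part P" "ground_ev e" for n e
    using H'[THEN conjunct2, THEN conjunct2, THEN conjunct2, rule_format, OF e0, of e n] that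
    by (simp add: reduct_def)
  have transfer: "holds M (Suc n) a (index_fm right_lit i)"
    if "i \<in> indices P" "holds M n a (index_fm left_lit i)" for n i
    using axiom[OF that(1), of n] axiom[OF that(1), of "Suc n"] index_step[OF that(1), of n] that(2)
    by (simp add: index_axiom_def index_step_def step_holds_def lit_holds_def del: index_fm.simps)
  define S where "S = nonground_steps P"
  have finS: "finite S" using finite_nonground_steps[OF mP] by (simp add: S_def)
  define D where "D = domain_of M"
  define R where "R n d d' \<longleftrightarrow>
      (\<forall>s\<in>S. lit_holds M n (left_lit s) [d] \<longrightarrow> lit_holds M (Suc n) (right_lit s) [d'])" for n d d'
  have total: "\<exists>d'\<in>D. R n d d'" if "d \<in> D" for n d
  proof -
    \<comment> \<open>The clauses triggered by \<open>d\<close>: an element with all their right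
      literals at the next moment is a successor of \<open>d\<close>.\<close>
    define J where "J = {s \<in> S. lit_holds M n (left_lit s) [d]}"
    have fin: "finite J" using finS by (simp add: J_def)
    have "(True, J, Var 0) \<in> indices P" by (auto simp: indices_def J_def S_def)
    from transfer[OF this, of n] that show ?thesis
      unfolding holds_index_fm[OF fin] by (auto simp: J_def R_def D_def)
  qed
  have onto: "\<exists>d\<in>D. R n d d'" if "d' \<in> D" for n d'
  proof -
    \<comment> \<open>By contraposition: \<open>d'\<close> refutes the universal right formula for
      \<open>J\<close>, so the left one fails at \<open>n\<close>. An element falsifying all left
      literals of \<open>J\<close> is a predecessor of \<open>d'\<close>.\<close>
    define J where "J = {s \<in> S. \<not> lit_holds M (Suc n) (right_lit s) [d']}"
    have fin: "finite J" using finS by (simp add: J_def)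
    have "(False, J, Var 0) \<in> indices P" by (auto simp: indices_def J_def S_def)
    from transfer[OF this, of n] that show ?thesis
      unfolding holds_index_fm[OF fin] by (auto simp: J_def R_def D_def)
  qed
  have const: "R n (const_of M c) (const_of M c)" if c: "c \<in> problem_consts P" for n c
    unfolding R_def
  proof (intro ballI impI)
    fix s assume s: "s \<in> S" and l: "lit_holds M n (left_lit s) [const_of M c]"
    \<comment> \<open>Successor and predecessor are prescribed here, so the clauses can be treated
      one at a time and singletons do.\<close>
    have "(True, {s}, Const c) \<in> indices P" using s c by (auto simp: indices_def S_def)
    from transfer[OF this, of n] e0 l show "lit_holds M (Suc n) (right_lit s) [const_of M c]"
      unfolding holds_index_fm[OF finite.insertI[OF finite.emptyI]] by auto
  qed
  define runs where "runs = {r. \<forall>n. r n \<in> D \<and> R n (r n) (r (Suc n))}"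
  have through: "\<exists>r\<in>runs. r n = d" if d: "d \<in> D" for n d
  proof -
    obtain r where "r n = d" "\<And>m. r m \<in> D" "\<And>m. R m (r m) (r (Suc m))"
      using run_through[of D R d n, OF total onto d] by blast
    then show ?thesis by (intro bexI[of _ r]) (simp_all add: runs_def)
  qed
  obtain r0 where r0: "r0 \<in> runs" using through e0 D_def by blast
  \<comment> \<open>A constant sequence at a constant outside the problem need not respect the step
    clauses; such constants denote the arbitrary run \<open>r0\<close>.\<close>
  define M' :: "(nat \<Rightarrow> nat) tstruct" where "M' = \<lparr>domain_of = runs,
      const_of = (\<lambda>c. if c \<in> problem_consts P then (\<lambda>_. const_of M c) else r0),
      pred_of = (\<lambda>n p rs. pred_of M n p (map (\<lambda>r. r n) rs))\<rparr>"
  have dom: "domain_of M' = runs" by (simp add: M'_def)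
  have M': "temporal_structure M'"
    using r0 const M by (auto simp: temporal_structure_def M'_def runs_def D_def)
  have lit: "lit_holds M' n l rs = lit_holds M n l (map (\<lambda>r. r n) rs)" for n l rs
    by (cases l) (simp_all add: lit_holds_def M'_def)
  have fm: "holds M' n b \<phi> \<longleftrightarrow> holds M n (\<lambda>x. b x n) \<phi>"
    if "first_order \<phi>" "fm_consts \<phi> \<subseteq> problem_consts P" for n b \<phi>
    using that
  proof (induction \<phi> arbitrary: b)
    case (Atom p ts)
    have "tm_val M' b t n = tm_val M (\<lambda>x. b x n) t" if "t \<in> set ts" for t
    proof (cases t)
      case (Const c)
      then have "c \<in> problem_consts P" using that Atom by force
      then show ?thesis by (simp add: Const M'_def)
    qed (simp add: M'_def)
    then have "map (\<lambda>r. r n) (map (tm_val M' b) ts) = map (tm_val M (\<lambda>x. b x n)) ts" by simp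
    moreover have "pred_of M' n p rs = pred_of M n p (map (\<lambda>r. r n) rs)" for rs
      by (simp add: M'_def)
    ultimately show ?case by (simp only: holds.simps)
  next
    case (Forall x \<phi>)
    have IH: "holds M' n c \<phi> \<longleftrightarrow> holds M n (\<lambda>x. c x n) \<phi>" for c
      using Forall by simp
    have upd: "(\<lambda>y. (b(x := r)) y n) = (\<lambda>y. b y n)(x := r n)" for r by auto
    have "holds M' n b (Forall x \<phi>) \<longleftrightarrow> (\<forall>r\<in>runs. holds M n ((\<lambda>y. b y n)(x := r n)) \<phi>)"
      by (simp only: holds.simps dom IH upd)
    also have "\<dots> \<longleftrightarrow> (\<forall>d\<in>D. holds M n ((\<lambda>y. b y n)(x := d)) \<phi>)"
      using through[of _ n] by (auto simp: runs_def)
    finally show ?case by (simp add: D_def)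
  next
    case (Exists x \<phi>)
    have IH: "holds M' n c \<phi> \<longleftrightarrow> holds M n (\<lambda>x. c x n) \<phi>" for c
      using Exists by simp
    have upd: "(\<lambda>y. (b(x := r)) y n) = (\<lambda>y. b y n)(x := r n)" for r by auto
    have "holds M' n b (Exists x \<phi>) \<longleftrightarrow> (\<exists>r\<in>runs. holds M n ((\<lambda>y. b y n)(x := r n)) \<phi>)"
      by (simp only: holds.simps dom IH upd)
    also have "\<dots> \<longleftrightarrow> (\<exists>d\<in>D. holds M n ((\<lambda>y. b y n)(x := d)) \<phi>)"
      using through[of _ n] by (auto simp: runs_def)
    finally show ?case by (simp add: D_def)
  qed auto
  have closed: "holds M' n (\<lambda>_. r0) \<phi> \<longleftrightarrow> holds M n a \<phi>"
    if "\<phi> \<in> universal_part P \<union> initial_part P" for n \<phi>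
  proof -
    have "first_order \<phi>" "fv \<phi> = {}" "fm_consts \<phi> \<subseteq> problem_consts P"
      using that mP by (auto simp: monodic_problem_def problem_consts_def)
    then show ?thesis using fm holds_cong[of \<phi>] by simp
  qed
  have "step_holds M' n s (if ground_step s then [] else [r])"
    if "s \<in> step_part P" "r \<in> runs" for n s r
    using that step by (auto simp: step_holds_def lit runs_def R_def S_def nonground_steps_def)
  moreover have "ev_holds M' n e (if ground_ev e then [] else [r])"
    if "e \<in> eventuality_part P" "r \<in> runs" for n e r
  proof -
    \<comment> \<open>Groundness of the eventualities is essential: propositions have the same truth
      values in \<open>M'\<close> and \<open>M\<close>, whereas an arbitrary run need not fulfil a
      non-ground eventuality.\<close>
    have "ground_ev e" using P that by (simp add: ground_eventuality_problem_def)
    then show ?thesis using ev[OF that(1), of n] by (simp add: ev_holds_def lit)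
  qed
  ultimately have "holds M' 0 (\<lambda>_. r0) (problem_fm P)"
    unfolding holds_problem_fm[OF mP] using init univ by (simp add: closed dom)
  moreover have "range (\<lambda>_ :: nat. r0) \<subseteq> domain_of M'"
    using r0 by (auto simp: M'_def)
  \<comment> \<open>The domain consists of functions; the Loewenheim-Skolem theorem leads back to
    natural numbers.\<close>
  ultimately show ?thesis using satisfiable_if_holds[OF M'] by blast
qed


section \<open>Size\<close>

lemma fm_size_big_conj:
  assumes "finite A"
  shows "fm_size (big_conj A) = 1 + (\<Sum>\<phi>\<in>A. 1 + fm_size \<phi>)"
proof -
  let ?xs = "map (inv fm_code) (sorted_list_of_set (fm_code ` A))"
  have "set ?xs = A"
    using assms by (simp add: image_image inv_f_f[OF inj_fm_code])
  moreover have "distinct ?xs"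
    by (auto simp: distinct_map assms intro!: inj_on_inv_into)
  moreover have "fm_size (foldr Conj xs Top) = 1 + (\<Sum>\<phi>\<leftarrow>xs. 1 + fm_size \<phi>)" for xs
    by (induction xs) auto
  ultimately show ?thesis
    unfolding big_conj_def by (metis sum_list_distinct_conv_sum_set)
qed

text \<open>The quantifier and the truth constant account for 3, and each clause for one connective
  and a literal of size at most 3.\<close>

lemma fm_size_index_fm: "fm_size (index_fm side (b, J, t)) \<le> 3 + 4 * card J"
proof -
  have lit: "fm_size (lit_fm l [t]) \<le> 3" for l by (cases l) simp_all
  have "fm_size (fold (\<lambda>s. Conj (lit_fm (side s) [t])) xs \<phi>) \<le> fm_size \<phi> + 4 * length xs" for xs \<phi>
  proof (induction xs arbitrary: \<phi>)
    case (Cons s xs)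
    show ?case using Cons[of "Conj (lit_fm (side s) [t]) \<phi>"] lit[of "side s"] by simp
  qed simp
  note c = this[of "listing J" Top]
  have "fm_size (fold (\<lambda>s. Disj (lit_fm (side s) [t])) xs \<phi>) \<le> fm_size \<phi> + 4 * length xs" for xs \<phi>
  proof (induction xs arbitrary: \<phi>)
    case (Cons s xs)
    show ?case using Cons[of "Disj (lit_fm (side s) [t]) \<phi>"] lit[of "side s"] by simp
  qed simp
  note d = this[of "listing J" Bot]
  show ?thesis using c d by (simp add: conj_lits_def disj_lits_def length_listing)
qed

text \<open>The 14 counts three conjunctions, three \<open>Always\<close>, two quantifiers of size 2
  and four \<open>Top\<close>. Eventualities stay an image because the reduct does not change
  them.\<close>

lemma problem_size_eq:
  assumes "monodic_problem P"
  shows "problem_size P = 14 + (\<Sum>\<phi>\<in>initial_part P. 1 + fm_size \<phi>)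
    + (\<Sum>\<phi>\<in>universal_part P. 1 + fm_size \<phi>) + (\<Sum>s\<in>step_part P. 1 + fm_size (step_fm s))
    + (\<Sum>\<phi>\<in>eventuality_fm ` eventuality_part P. 1 + fm_size \<phi>)"
proof -
  have "inj step_fm"
  proof (rule injI)
    fix s t assume "step_fm s = step_fm t"
    moreover have "lit_fm l ts = lit_fm l' ts' \<longleftrightarrow> l = l' \<and> ts = ts'" for l l' ts ts'
      by (cases l; cases l') auto
    ultimately show "s = t" by (cases s; cases t) (auto simp: step_fm_def)
  qed
  then have "(\<Sum>\<phi>\<in>step_fm ` step_part P. 1 + fm_size \<phi>) = (\<Sum>s\<in>step_part P. 1 + fm_size (step_fm s))"
    by (subst sum.reindex) (auto intro: inj_on_subset)
  then show ?thesis
    using assms by (simp add: problem_size_def problem_fm_def fm_size_big_conj monodic_problem_def)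
qed

text \<open>With \<open>S\<close> the given size there are at most
  \<open>2 * (2 ^ S * (1 + S))\<close> indices, each contributing an axiom of size linear in
  \<open>S\<close> and a step clause of constant size.\<close>

lemma problem_size_reduct:
  assumes P: "ground_eventuality_problem P"
  shows "problem_size (reduct P) \<le> 2 ^ (10 * problem_size P)"
proof -
  define S where "S = problem_size P"
  let ?N = "problem_code P"
  have mP: "monodic_problem P" using P by (simp add: ground_eventuality_problem_def)
  then have fin: "finite (universal_part P)" "finite (initial_part P)" "finite (step_part P)"
    by (auto simp: monodic_problem_def)
  \<comment> \<open>Lets additive constants be absorbed into the exponent at the end.\<close>
  have S: "S \<ge> 14" unfolding S_def problem_size_eq[OF mP] by simp
  have "card (nonground_steps P) \<le> card (step_part P)"
    using fin by (auto simp: nonground_steps_def intro: card_mono)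
  also have "\<dots> \<le> (\<Sum>s\<in>step_part P. 1 + fm_size (step_fm s))"
    by (simp only: card_eq_sum) (rule sum_mono, simp)
  also have "\<dots> \<le> S" unfolding S_def problem_size_eq[OF mP] by simp
  finally have k: "card (nonground_steps P) \<le> S" .
  have sz: "(\<Sum>\<phi>\<in>A. card (fm_consts \<phi>)) \<le> (\<Sum>\<phi>\<in>A. 1 + fm_size \<phi>)" for A
    by (rule sum_mono) (rule order_trans[OF card_fm_consts], simp)
  have "card (problem_consts P)
      \<le> (\<Sum>\<phi>\<in>universal_part P. card (fm_consts \<phi>)) + (\<Sum>\<phi>\<in>initial_part P. card (fm_consts \<phi>))"
    unfolding problem_consts_def image_Un Union_Un_distrib
    by (rule order_trans[OF card_Un_le] add_mono card_UN_le fin)+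
  also have "\<dots> \<le> S"
    using sz[of "universal_part P"] sz[of "initial_part P"]
    unfolding S_def problem_size_eq[OF mP] by linarith
  finally have c: "card (problem_consts P) \<le> S" .
  have "card (insert (Var 0) (Const ` problem_consts P)) \<le> 1 + S"
    using card_insert_le_m1 card_image_le[OF finite_problem_consts[OF mP], of Const] c
    by (simp add: card_insert_if finite_problem_consts[OF mP])
  moreover have "card (Pow (nonground_steps P)) \<le> 2 ^ S"
    using k by (simp add: card_Pow finite_nonground_steps[OF mP])
  ultimately have "card (indices P) \<le> 2 * (2 ^ S * (1 + S))"
    unfolding indices_def card_cartesian_product by (intro mult_mono) auto
  also have "\<dots> \<le> 2 * (2 ^ S * 2 ^ S)"
    by (intro mult_mono) (simp_all add: Suc_le_eq less_exp)
  finally have V: "card (indices P) \<le> 2 * (2 ^ S * 2 ^ S)" .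
  have ax: "1 + fm_size (index_axiom ?N i) \<le> 12 + 8 * S" if "i \<in> indices P" for i
  proof -
    obtain b J t where i: "i = (b, J, t)" by (metis surj_pair)
    have "card J \<le> card (nonground_steps P)"
      using that i finite_nonground_steps[OF mP] by (auto simp: indices_def intro: card_mono)
    with k fm_size_index_fm[of left_lit b J t] fm_size_index_fm[of right_lit b J t]
    show ?thesis unfolding index_axiom_def i fm_size.simps list.size by linarith
  qed
  have "problem_size (reduct P) \<le> S + (\<Sum>i\<in>indices P. 1 + fm_size (index_axiom ?N i))
      + (\<Sum>i\<in>indices P. 1 + fm_size (step_fm (index_step ?N i)))"
  proof -
    have U: "(\<Sum>\<phi>\<in>universal_part P \<union> index_axiom ?N ` indices P. 1 + fm_size \<phi>)
        = (\<Sum>\<phi>\<in>universal_part P. 1 + fm_size \<phi>) + (\<Sum>i\<in>indices P. 1 + fm_size (index_axiom ?N i))"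
      using index_axiom_notin[OF mP] fin finite_indices[OF mP]
      by (subst sum.union_disjoint) (auto simp: sum.reindex[OF inj_on_index_axiom[OF mP]])
    have "(\<Sum>s\<in>{s \<in> step_part P. ground_step s} \<union> index_step ?N ` indices P. 1 + fm_size (step_fm s))
        = (\<Sum>s\<in>{s \<in> step_part P. ground_step s}. 1 + fm_size (step_fm s))
          + (\<Sum>i\<in>indices P. 1 + fm_size (step_fm (index_step ?N i)))"
      using index_step_notin[OF mP] fin finite_indices[OF mP]
      by (subst sum.union_disjoint) (auto simp: sum.reindex[OF inj_on_index_step[OF mP]])
    moreover have "(\<Sum>s\<in>{s \<in> step_part P. ground_step s}. 1 + fm_size (step_fm s))
        \<le> (\<Sum>s\<in>step_part P. 1 + fm_size (step_fm s))"
      using fin by (intro sum_mono2) auto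
    ultimately show ?thesis
      unfolding problem_size_eq[OF monodic_reduct[OF P]] S_def problem_size_eq[OF mP]
      by (simp only: reduct_def problem.simps U)
  qed
  also have "(\<Sum>i\<in>indices P. 1 + fm_size (step_fm (index_step ?N i))) = card (indices P) * 5"
    by (simp add: step_fm_def index_step_def)
  also have "(\<Sum>i\<in>indices P. 1 + fm_size (index_axiom ?N i)) \<le> card (indices P) * (12 + 8 * S)"
    using sum_bounded_above[OF ax] by simp
  also have "S + card (indices P) * (12 + 8 * S) + card (indices P) * 5
      = S + card (indices P) * (17 + 8 * S)" by (simp add: algebra_simps)
  also have "\<dots> \<le> 2 ^ S + 2 * (2 ^ S * 2 ^ S) * (32 * 2 ^ S)"
  proof (intro add_mono mult_mono V)
    show "S \<le> 2 ^ S" using less_exp[of S] by linarith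
    show "17 + 8 * S \<le> 32 * 2 ^ S" using less_exp[of S] S by linarith
  qed auto
  also have "\<dots> = 2 ^ S + 2 ^ (3 * S + 6)"
  proof -
    have "3 * S + 6 = S + (S + (S + 6))" by simp
    then show ?thesis by (simp only: power_add) simp
  qed
  also have "\<dots> \<le> 2 ^ (3 * S + 6) + 2 ^ (3 * S + 6)"
    by (intro add_mono power_increasing) auto
  also have "\<dots> = 2 ^ (3 * S + 7)" by (simp add: power_add)
  also have "\<dots> \<le> 2 ^ (10 * S)" using S by (intro power_increasing) auto
  finally show ?thesis by (simp add: S_def)
qed


section \<open>Effectiveness\<close>

definition code_hd :: "nat \<Rightarrow> nat" where "code_hd x = pfst (x - 1)"
definition code_tl :: "nat \<Rightarrow> nat" where "code_tl x = psnd (x - 1)"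

lemma code_hd_Cons [simp]: "code_hd (Suc (prod_encode (a, b))) = a"
  and code_tl_Cons [simp]: "code_tl (Suc (prod_encode (a, b))) = b"
  by (simp_all add: code_hd_def code_tl_def)

text \<open>Dropping past the end of a list thus stays at 0, the code of the empty list.\<close>

lemma code_tl_0 [simp]: "code_tl 0 = 0"
  using psnd_prod_encode[of 0 0] by (simp add: code_tl_def prod_encode_def)

lemma recursive_code_hd: "recursive n f \<Longrightarrow> recursive n (\<lambda>xs. code_hd (f xs))"
  unfolding code_hd_def by (intro recursive_intros)

lemma recursive_code_tl: "recursive n f \<Longrightarrow> recursive n (\<lambda>xs. code_tl (f xs))"
  unfolding code_tl_def by (intro recursive_intros)

definition code_drop :: "nat \<Rightarrow> nat \<Rightarrow> nat" where
  "code_drop k l = rec_nat l (\<lambda>_ r. code_tl r) k"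

lemma code_drop: "code_drop k (list_encode xs) = list_encode (drop k xs)"
proof (induction k)
  case (Suc k)
  have "drop (Suc k) xs = tl (drop k xs)" by (simp add: drop_Suc tl_drop)
  with Suc show ?case
    by (cases "drop k xs") (simp_all add: code_drop_def)
qed (simp add: code_drop_def)

lemma recursive_code_drop: "recursive2 code_drop"
proof -
  have "recursive2 (\<lambda>k l. rec_nat l (\<lambda>_ r. code_tl r) k)"
    by (rule recursive2_rec_nat) (auto simp: recursive_defs intro!: recursive_intros recursive_code_tl)
  then show ?thesis by (simp add: code_drop_def[abs_def])
qed

text \<open>The code of a list bounds its length, so searching positions below \<open>l\<close>
  misses none; a nonzero remainder means that position \<open>k\<close> exists.\<close>

definition code_member :: "nat \<Rightarrow> nat \<Rightarrow> bool" where
  "code_member a l \<longleftrightarrow> (\<exists>k<l. code_drop k l \<noteq> 0 \<and> code_hd (code_drop k l) = a)"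

lemma length_le_list_encode: "length xs \<le> list_encode xs"
  by (induction xs) (auto intro: order_trans[OF _ prod_encode_bounds(2)])

lemma code_member: "code_member a (list_encode xs) \<longleftrightarrow> a \<in> set xs"
proof -
  have "list_encode (drop k xs) \<noteq> 0 \<and> code_hd (list_encode (drop k xs)) = a
      \<longleftrightarrow> k < length xs \<and> xs ! k = a" for k
    by (cases "drop k xs") (auto dest: nth_via_drop simp: drop_eq_Nil2 not_le[symmetric])
  then show ?thesis
    using length_le_list_encode[of xs]
    by (auto simp: code_member_def code_drop in_set_conv_nth intro: less_le_trans)
qed

lemma decidable_code_member: "decidable2 code_member"
  unfolding decidable2_def code_member_def
  by (rule decidable_Bex[of "\<lambda>k a l. code_drop k l \<noteq> 0 \<and> code_hd (code_drop k l) = a"])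
    (auto simp: decidable3_def
      intro!: recursive_intros recursive_code_hd recursive_comp2[OF recursive_code_drop])

text \<open>Whether the term with code \<open>t\<close> occurs in the formula with code \<open>f\<close>, given the set \<open>B\<close> of
  the codes below \<open>f\<close> of formulae in which it occurs.  The mask below is the course of values of
  this recursion, as a bit set.\<close>

definition occurs_step :: "nat \<Rightarrow> nat \<Rightarrow> nat \<Rightarrow> bool" where
  "occurs_step t f B \<longleftrightarrow>
     pfst f = 0 \<and> code_member t (psnd (psnd f)) \<or>
     (pfst f = 3 \<or> 10 \<le> pfst f) \<and> psnd f \<in> set_decode B \<or>
     (4 \<le> pfst f \<and> pfst f \<le> 7) \<and>
       (pfst (psnd f) \<in> set_decode B \<or> psnd (psnd f) \<in> set_decode B) \<or>
     (pfst f = 8 \<or> pfst f = 9) \<and> psnd (psnd f) \<in> set_decode B"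

definition occurs_mask :: "nat \<Rightarrow> nat \<Rightarrow> nat" where
  "occurs_mask m t = rec_nat 0 (\<lambda>f B. B + (if occurs_step t f B then 2 ^ f else 0)) m"

lemma decidable_occurs_step: "decidable3 occurs_step"
  unfolding decidable3_def occurs_step_def
  by (intro recursive_intros decidable_comp2[OF decidable_code_member]) simp_all

lemma recursive_occurs_mask: "recursive2 occurs_mask"
proof -
  have "recursive2 (\<lambda>m t. rec_nat 0 (\<lambda>f B. B + (if occurs_step t f B then 2 ^ f else 0)) m)"
    by (rule recursive2_rec_nat)
      (auto simp: recursive1_def recursive3_def
        intro!: recursive_intros decidable_comp3[OF decidable_occurs_step])
  then show ?thesis by (simp add: occurs_mask_def[abs_def])
qed

text \<open>Bit \<open>f\<close> is decided at stage \<open>f\<close>, when it is still unset, and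
  never changes afterwards.\<close>

lemma set_decode_occurs_mask:
  "set_decode (occurs_mask m t) = {f. f < m \<and> occurs_step t f (occurs_mask f t)}"
proof (induction m)
  case (Suc m)
  then have "m \<notin> set_decode (occurs_mask m t)" by simp
  note ins = set_decode_plus_power_2[OF this]
  have "occurs_mask (Suc m) t =
      (if occurs_step t m (occurs_mask m t) then 2 ^ m else 0) + occurs_mask m t"
    by (simp add: occurs_mask_def)
  then show ?case using Suc ins by (auto simp: less_Suc_eq)
qed (simp add: occurs_mask_def)

text \<open>With a positive constructor tag this puts the codes of subformulae strictly below that
  of the formula, as the course-of-values recursion requires.\<close>

lemma add_le_prod_encode: "a + b \<le> prod_encode (a, b)"
proof -
  have "m \<le> triangle m" for m by (induction m) auto
  from this[of "a + b"] show ?thesis by (simp add: prod_encode_def)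
qed

text \<open>The stage \<open>m\<close> is arbitrary in the induction because subformulae are looked
  up in the mask whose stage is the code of the whole formula.\<close>

lemma occurs_mask_iff:
  "fm_code \<phi> \<in> set_decode (occurs_mask m (tm_code (Const c)))
     \<longleftrightarrow> fm_code \<phi> < m \<and> c \<in> fm_consts \<phi>"
proof (induction \<phi> arbitrary: m)
  case (Atom p ts)
  have "c \<in> tm_consts t \<longleftrightarrow> tm_code t = tm_code (Const c)" for t
    by (cases t) auto
  then have "c \<in> fm_consts (Atom p ts) \<longleftrightarrow> tm_code (Const c) \<in> set (map tm_code ts)"
    by (auto simp del: tm_code.simps) (metis imageI)
  then show ?case
    unfolding set_decode_occurs_mask by (simp add: occurs_step_def code_member del: tm_code.simps)
next
  case Top
  show ?case unfolding set_decode_occurs_mask by (simp add: occurs_step_def)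
next
  case Bot
  show ?case unfolding set_decode_occurs_mask by (simp add: occurs_step_def)
next
  case (Neg \<phi>)
  have "fm_code \<phi> < fm_code (Neg \<phi>)" using add_le_prod_encode[of 3 "fm_code \<phi>"] by simp
  then show ?case by (subst set_decode_occurs_mask) (simp add: occurs_step_def Neg del: tm_code.simps)
next
  case (Conj \<phi> \<psi>)
  have "fm_code \<phi> < fm_code (Conj \<phi> \<psi>)" "fm_code \<psi> < fm_code (Conj \<phi> \<psi>)"
    using add_le_prod_encode[of 4 "prod_encode (fm_code \<phi>, fm_code \<psi>)"]
      add_le_prod_encode[of "fm_code \<phi>" "fm_code \<psi>"] by simp_all
  then show ?case by (subst set_decode_occurs_mask) (simp add: occurs_step_def Conj del: tm_code.simps)
next
  case (Disj \<phi> \<psi>)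
  have "fm_code \<phi> < fm_code (Disj \<phi> \<psi>)" "fm_code \<psi> < fm_code (Disj \<phi> \<psi>)"
    using add_le_prod_encode[of 5 "prod_encode (fm_code \<phi>, fm_code \<psi>)"]
      add_le_prod_encode[of "fm_code \<phi>" "fm_code \<psi>"] by simp_all
  then show ?case by (subst set_decode_occurs_mask) (simp add: occurs_step_def Disj del: tm_code.simps)
next
  case (Imp \<phi> \<psi>)
  have "fm_code \<phi> < fm_code (Imp \<phi> \<psi>)" "fm_code \<psi> < fm_code (Imp \<phi> \<psi>)"
    using add_le_prod_encode[of 6 "prod_encode (fm_code \<phi>, fm_code \<psi>)"]
      add_le_prod_encode[of "fm_code \<phi>" "fm_code \<psi>"] by simp_all
  then show ?case by (subst set_decode_occurs_mask) (simp add: occurs_step_def Imp del: tm_code.simps)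
next
  case (Iff \<phi> \<psi>)
  have "fm_code \<phi> < fm_code (Iff \<phi> \<psi>)" "fm_code \<psi> < fm_code (Iff \<phi> \<psi>)"
    using add_le_prod_encode[of 7 "prod_encode (fm_code \<phi>, fm_code \<psi>)"]
      add_le_prod_encode[of "fm_code \<phi>" "fm_code \<psi>"] by simp_all
  then show ?case by (subst set_decode_occurs_mask) (simp add: occurs_step_def Iff del: tm_code.simps)
next
  case (Forall x \<phi>)
  have "fm_code \<phi> < fm_code (Forall x \<phi>)"
    using add_le_prod_encode[of 8 "prod_encode (x, fm_code \<phi>)"]
      add_le_prod_encode[of x "fm_code \<phi>"] by simp
  then show ?case by (subst set_decode_occurs_mask) (simp add: occurs_step_def Forall del: tm_code.simps)
next
  case (Exists x \<phi>)
  have "fm_code \<phi> < fm_code (Exists x \<phi>)"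
    using add_le_prod_encode[of 9 "prod_encode (x, fm_code \<phi>)"]
      add_le_prod_encode[of x "fm_code \<phi>"] by simp
  then show ?case by (subst set_decode_occurs_mask) (simp add: occurs_step_def Exists del: tm_code.simps)
next
  case (Next \<phi>)
  have "fm_code \<phi> < fm_code (Next \<phi>)" using add_le_prod_encode[of 10 "fm_code \<phi>"] by simp
  then show ?case by (subst set_decode_occurs_mask) (simp add: occurs_step_def Next del: tm_code.simps)
next
  case (Sometime \<phi>)
  have "fm_code \<phi> < fm_code (Sometime \<phi>)" using add_le_prod_encode[of 11 "fm_code \<phi>"] by simp
  then show ?case by (subst set_decode_occurs_mask) (simp add: occurs_step_def Sometime del: tm_code.simps)
next
  case (Always \<phi>)
  have "fm_code \<phi> < fm_code (Always \<phi>)" using add_le_prod_encode[of 12 "fm_code \<phi>"] by simp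
  then show ?case by (subst set_decode_occurs_mask) (simp add: occurs_step_def Always del: tm_code.simps)
qed

text \<open>Bounds the term component of index codes, for \<open>index_code_less\<close>.\<close>

lemma fm_consts_code_le: "c \<in> fm_consts \<phi> \<Longrightarrow> tm_code (Const c) \<le> fm_code \<phi>"
proof (induction \<phi>)
  case (Atom p ts)
  then obtain t where "t \<in> set ts" "c \<in> tm_consts t" by auto
  moreover from this(2) have "t = Const c" by (cases t) simp_all
  ultimately have "Const c \<in> set ts" by simp
  moreover have "x \<in> set xs \<Longrightarrow> x \<le> list_encode xs" for x xs
    by (induction xs) (auto intro: le_SucI prod_encode_bounds order_trans[OF _ prod_encode_bounds(2)])
  ultimately have "tm_code (Const c) \<le> list_encode (map tm_code ts)" by force
  then show ?case by (auto intro: order_trans[OF _ prod_encode_bounds(2)] simp del: tm_code.simps)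
qed (auto intro: order_trans[OF _ prod_encode_bounds(2)] order_trans[OF _ prod_encode_bounds(1)]
    simp del: tm_code.simps)

section \<open>Index formulae on codes\<close>

text \<open>\<open>Suc (prod_encode (t, 0))\<close> codes the one-element argument list, and tag 3
  is negation.\<close>

definition literal_code :: "nat \<Rightarrow> nat \<Rightarrow> nat" where
  "literal_code l t =
     (if pfst l = 0 then prod_encode (0, prod_encode (psnd l, Suc (prod_encode (t, 0))))
      else prod_encode (3, prod_encode (0, prod_encode (psnd l, Suc (prod_encode (t, 0))))))"

lemma fm_code_lit_fm: "fm_code (lit_fm l [t]) = literal_code (lit_code l) (tm_code t)"
  by (cases l) (simp_all add: literal_code_def)

text \<open>\<open>v\<close> is an index code, with flag, clause set and term as components.
  Scanning the numbers below \<open>m\<close> upwards reproduces the fold over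
  \<open>listing\<close>; the tags 1, 2, 4 and 5 are those of \<open>Top\<close>,
  \<open>Bot\<close>, \<open>Conj\<close> and \<open>Disj\<close>.\<close>

definition lits_code :: "(nat \<Rightarrow> nat) \<Rightarrow> nat \<Rightarrow> nat \<Rightarrow> nat" where
  "lits_code side m v = rec_nat (if pfst v = 1 then prod_encode (1, 0) else prod_encode (2, 0))
     (\<lambda>n r. if n \<in> set_decode (pfst (psnd v))
        then prod_encode (if pfst v = 1 then 4 else 5,
               prod_encode (literal_code (side n) (psnd (psnd v)), r))
        else r) m"

text \<open>An index code exceeds the codes of all its clauses, so \<open>v\<close> doubles as the
  bound of the scan.\<close>

definition index_fm_code :: "(nat \<Rightarrow> nat) \<Rightarrow> nat \<Rightarrow> nat" where
  "index_fm_code side v =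
     prod_encode (if pfst v = 1 then 9 else 8, prod_encode (0, lits_code side v v))"

lemma recursive_index_fm_code:
  assumes "recursive1 side" shows "recursive1 (index_fm_code side)"
proof -
  have "recursive2 (\<lambda>m v. rec_nat (if pfst v = 1 then prod_encode (1, 0) else prod_encode (2, 0))
     (\<lambda>n r. if n \<in> set_decode (pfst (psnd v))
        then prod_encode (if pfst v = 1 then 4 else 5,
               prod_encode (literal_code (side n) (psnd (psnd v)), r))
        else r) m)"
    by (rule recursive2_rec_nat) (simp_all only: recursive1_def recursive3_def literal_code_def,
      (intro recursive_intros recursive_comp1[OF assms], simp_all)+)
  then have *: "recursive2 (lits_code side)" by (simp add: lits_code_def[abs_def])
  show ?thesis unfolding recursive1_def index_fm_code_def
    by (intro recursive_intros recursive_comp2[OF *]) simp_all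
qed

lemma fm_code_fold_listing:
  assumes J: "finite J" "step_code ` J \<subseteq> {..<m}"
    and con: "\<And>\<phi> \<psi>. fm_code (con \<phi> \<psi>) = prod_encode (k, prod_encode (fm_code \<phi>, fm_code \<psi>))"
    and g: "\<And>s. s \<in> J \<Longrightarrow> g (step_code s) = fm_code (f s)"
  shows "fm_code (fold (\<lambda>s. con (f s)) (listing J) \<phi>) =
    rec_nat (fm_code \<phi>) (\<lambda>n r. if n \<in> step_code ` J then prod_encode (k, prod_encode (g n, r)) else r) m"
proof -
  let ?xs = "filter (\<lambda>n. n \<in> step_code ` J) [0..<m]"
  have "sorted_list_of_set (step_code ` J) = ?xs"
  proof -
    have "set ?xs = step_code ` J" using J(2) by auto
    then show ?thesis
      using sorted_list_of_set.idem_if_sorted_distinct[of ?xs] by (simp add: sorted_wrt_filter)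
  qed
  then have "listing J = map (inv step_code) ?xs" by (simp add: listing_def)
  \<comment> \<open>Stated for every bound, since the induction passes through bounds that do not
    yet cover \<open>J\<close>.\<close>
  moreover have "fm_code (fold (\<lambda>s. con (f s))
        (map (inv step_code) (filter (\<lambda>n. n \<in> step_code ` J) [0..<m])) \<phi>) =
      rec_nat (fm_code \<phi>) (\<lambda>n r. if n \<in> step_code ` J then prod_encode (k, prod_encode (g n, r)) else r) m"
    for m
  proof (induction m)
    case (Suc m)
    have "g m = fm_code (f (inv step_code m))" if "m \<in> step_code ` J"
      using that g by (auto simp: inv_f_f[OF inj_step_code])
    then show ?case using Suc by (simp add: con)
  qed simp
  ultimately show ?thesis by metis
qed

lemma fm_code_index_fm:
  assumes J: "finite J" and side: "\<And>s. side' (step_code s) = lit_code (side s)"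
  shows "fm_code (index_fm side (b, J, t)) = index_fm_code side' (index_code (b, J, t))"
proof -
  let ?v = "index_code (b, J, t)"
  have "step_code s < ?v" if "s \<in> J" for s
  proof -
    have "step_code s < set_encode (step_code ` J)"
      using that J by (intro less_set_encode) auto
    also have "\<dots> \<le> ?v" by (auto intro: order_trans[OF prod_encode_bounds(1) prod_encode_bounds(2)])
    finally show ?thesis .
  qed
  then have sub: "step_code ` J \<subseteq> {..<?v}" by auto
  have lit: "literal_code (side' (step_code s)) (tm_code t) = fm_code (lit_fm (side s) [t])" for s
    by (simp add: fm_code_lit_fm side)
  note fold = fm_code_fold_listing[OF J sub,
      where g = "\<lambda>n. literal_code (side' n) (tm_code t)" and f = "\<lambda>s. lit_fm (side s) [t]"]
  have v: "pfst ?v = of_bool b" "pfst (psnd ?v) = set_encode (step_code ` J)"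
    "psnd (psnd ?v) = tm_code t" by simp_all
  have "fm_code (conj_lits side J t) = lits_code side' ?v ?v" if b
    using fold[of Conj 4 Top] that J unfolding conj_lits_def lits_code_def v by (simp add: lit)
  moreover have "fm_code (disj_lits side J t) = lits_code side' ?v ?v" if "\<not> b"
    using fold[of Disj 5 Bot] that J unfolding disj_lits_def lits_code_def v by (simp add: lit)
  ultimately show ?thesis by (simp add: index_fm_code_def)
qed


section \<open>The transformation on codes\<close>

abbreviation universal_code :: "nat \<Rightarrow> nat" where "universal_code x \<equiv> code_hd x"
abbreviation initial_code :: "nat \<Rightarrow> nat" where "initial_code x \<equiv> code_hd (code_tl x)"
abbreviation steps_code :: "nat \<Rightarrow> nat" where "steps_code x \<equiv> code_hd (code_tl (code_tl x))"
abbreviation evs_code :: "nat \<Rightarrow> nat" where "evs_code x \<equiv> code_hd (code_tl (code_tl (code_tl x)))"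

text \<open>For \<open>x = problem_code P\<close> this recognizes the codes of
  \<open>indices P\<close>. Tag 1 marks non-ground clauses and also constants, and 0 is the code of
  \<open>Var 0\<close>.\<close>

definition is_index_code :: "nat \<Rightarrow> nat \<Rightarrow> bool" where
  "is_index_code x v \<longleftrightarrow> pfst v \<le> 1 \<and>
     (\<forall>n<pfst (psnd v). n \<in> set_decode (pfst (psnd v)) \<longrightarrow>
        n \<in> set_decode (steps_code x) \<and> pfst n = 1) \<and>
     (psnd (psnd v) = 0 \<or> pfst (psnd (psnd v)) = 1 \<and>
        (\<exists>f<x. (f \<in> set_decode (universal_code x) \<or> f \<in> set_decode (initial_code x)) \<and>
           f \<in> set_decode (occurs_mask x (psnd (psnd v)))))"

text \<open>Flag, clause set and term of an index have codes at most 1, \<open>x\<close> and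
  \<open>x\<close>, and pairing is monotone.\<close>

definition index_bound :: "nat \<Rightarrow> nat" where
  "index_bound x = Suc (prod_encode (1, prod_encode (x, x)))"

definition index_axiom_code :: "nat \<Rightarrow> nat \<Rightarrow> nat" where
  "index_axiom_code x v = prod_encode (4, prod_encode
     (prod_encode (6, prod_encode (index_fm_code (\<lambda>n. pfst (psnd n)) v,
        prod_encode (0, prod_encode (x + 2 * v + 1, 0)))),
      prod_encode (6, prod_encode (prod_encode (0, prod_encode (x + 2 * v + 2, 0)),
        index_fm_code (\<lambda>n. psnd (psnd n)) v))))"

definition index_step_code :: "nat \<Rightarrow> nat \<Rightarrow> nat" where
  "index_step_code x v = prod_encode (0, prod_encode
     (prod_encode (0, x + 2 * v + 1), prod_encode (0, x + 2 * v + 2)))"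

text \<open>On canonical indices a union is an addition and an image is a sum of powers of two,
  provided that the parts are disjoint and the enumeration is injective.\<close>

definition reduct_code :: "nat \<Rightarrow> nat" where
  "reduct_code x = Suc (prod_encode
     (universal_code x
        + (\<Sum>v<index_bound x. if is_index_code x v then 2 ^ index_axiom_code x v else 0),
      Suc (prod_encode (initial_code x,
      Suc (prod_encode
        ((\<Sum>n<steps_code x. if n \<in> set_decode (steps_code x) \<and> pfst n = 0 then 2 ^ n else 0)
          + (\<Sum>v<index_bound x. if is_index_code x v then 2 ^ index_step_code x v else 0),
      Suc (prod_encode (evs_code x, 0))))))))"

lemma decidable_is_index_code: "decidable2 is_index_code"
proof -
  have 1: "decidable3 (\<lambda>n j s. n \<in> set_decode j \<longrightarrow> n \<in> set_decode s \<and> pfst n = 1)"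
    unfolding decidable3_def by (intro recursive_intros) simp_all
  have 2: "decidable3 (\<lambda>f x t. (f \<in> set_decode (universal_code x) \<or> f \<in> set_decode (initial_code x)) \<and>
      f \<in> set_decode (occurs_mask x t))"
    unfolding decidable3_def
    by (intro recursive_intros recursive_code_hd recursive_code_tl
        recursive_comp2[OF recursive_occurs_mask]) simp_all
  show ?thesis
    unfolding decidable2_def is_index_code_def
    by (intro recursive_intros recursive_code_hd recursive_code_tl
        decidable_Ball[OF 1] decidable_Bex[OF 2]) simp_all
qed

lemma recursive_reduct_code: "recursive1 reduct_code"
proof -
  have side: "recursive1 (\<lambda>n. pfst (psnd n))" "recursive1 (\<lambda>n. psnd (psnd n))"
    unfolding recursive1_def by (intro recursive_intros, simp)+
  have 1: "recursive2 (\<lambda>v x. if is_index_code x v then 2 ^ index_axiom_code x v else 0)"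
    unfolding recursive2_def index_axiom_code_def
    by (intro recursive_intros decidable_comp2[OF decidable_is_index_code]
        recursive_comp1[OF recursive_index_fm_code[OF side(1)]]
        recursive_comp1[OF recursive_index_fm_code[OF side(2)]]) simp_all
  have 2: "recursive2 (\<lambda>v x. if is_index_code x v then 2 ^ index_step_code x v else 0)"
    unfolding recursive2_def index_step_code_def
    by (intro recursive_intros decidable_comp2[OF decidable_is_index_code]) simp_all
  have 3: "recursive2 (\<lambda>n s. if n \<in> set_decode s \<and> pfst n = 0 then 2 ^ n else 0)"
    unfolding recursive2_def by (intro recursive_intros) simp_all
  show ?thesis
    unfolding recursive1_def reduct_code_def index_bound_def
    by (intro recursive_intros recursive_code_hd recursive_code_tl
        recursive_comp2[OF recursive2_sum[OF 1]] recursive_comp2[OF recursive2_sum[OF 2]]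
        recursive_comp2[OF recursive2_sum[OF 3]]) simp_all
qed

section \<open>Correctness of the transformation on codes\<close>

lemma problem_code_parts:
  "universal_code (problem_code P) = set_encode (fm_code ` universal_part P)"
  "initial_code (problem_code P) = set_encode (fm_code ` initial_part P)"
  "steps_code (problem_code P) = set_encode (step_code ` step_part P)"
  "evs_code (problem_code P) = set_encode (eventuality_code ` eventuality_part P)"
  by (simp_all add: problem_code_eq)

lemma pfst_step_code: "pfst (step_code s) = of_bool (\<not> ground_step s)"
  by (cases s) simp_all

lemma lit_code_left_lit: "pfst (psnd (step_code s)) = lit_code (left_lit s)"
  by (cases s) simp_all

lemma lit_code_right_lit: "psnd (psnd (step_code s)) = lit_code (right_lit s)"
  by (cases s) simp_all

lemma prod_encode_mono: "a \<le> c \<Longrightarrow> b \<le> d \<Longrightarrow> prod_encode (a, b) \<le> prod_encode (c, d)"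
  unfolding prod_encode_def prod.case by (intro add_mono triangle_mono)

lemma index_code_less:
  assumes P: "monodic_problem P" and i: "i \<in> indices P"
  shows "index_code i < index_bound (problem_code P)"
proof -
  let ?x = "problem_code P"
  obtain b J t where ieq: "i = (b, J, t)" by (metis surj_pair)
  have J: "J \<subseteq> step_part P" and t: "t = Var 0 \<or> (\<exists>c\<in>problem_consts P. t = Const c)"
    using i ieq by (auto simp: indices_def nonground_steps_def)
  have "set_encode (step_code ` J) \<le> set_encode (step_code ` step_part P)"
    unfolding set_encode_def using P J by (intro sum_mono2) (auto simp: monodic_problem_def)
  then have "set_encode (step_code ` J) \<le> ?x" using part_less_problem_code(3)[of P] by linarith
  moreover have "tm_code t \<le> ?x"
    using t
  proof (elim disjE bexE)
    fix c assume "c \<in> problem_consts P" and t: "t = Const c"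
    then obtain \<phi> where "\<phi> \<in> universal_part P \<union> initial_part P" "c \<in> fm_consts \<phi>"
      by (auto simp: problem_consts_def)
    then show ?thesis
      using member_less_problem_code(1)[OF P] fm_consts_code_le unfolding t by fastforce
  qed (simp add: prod_encode_def)
  ultimately show ?thesis
    unfolding index_bound_def ieq less_Suc_eq_le by (auto intro!: prod_encode_mono)
qed

lemma is_index_code_iff:
  assumes P: "monodic_problem P"
  shows "is_index_code (problem_code P) v \<longleftrightarrow> v \<in> index_code ` indices P"
proof -
  let ?x = "problem_code P" and ?b = "pfst v" and ?j = "pfst (psnd v)" and ?t = "psnd (psnd v)"
  have fin: "finite (universal_part P)" "finite (initial_part P)" "finite (step_part P)"
    using P by (auto simp: monodic_problem_def)
  have v: "v = prod_encode (?b, prod_encode (?j, ?t))" by simp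
  have J: "(\<forall>n<?j. n \<in> set_decode ?j \<longrightarrow> n \<in> set_decode (steps_code ?x) \<and> pfst n = 1)
      \<longleftrightarrow> set_decode ?j \<subseteq> step_code ` nonground_steps P"
  proof -
    have "n \<in> set_decode (steps_code ?x) \<and> pfst n = 1 \<longleftrightarrow> n \<in> step_code ` nonground_steps P" for n
      by (auto simp: problem_code_parts fin nonground_steps_def pfst_step_code)
    then show ?thesis using set_decode_less by blast
  qed
  \<comment> \<open>All formulae of the problem have codes below \<open>?x\<close>, so the mask of
    stage \<open>?x\<close> has decided every one of them.\<close>
  have occ: "(\<exists>f<?x. (f \<in> set_decode (universal_code ?x) \<or> f \<in> set_decode (initial_code ?x)) \<and>
        f \<in> set_decode (occurs_mask ?x (tm_code (Const c)))) \<longleftrightarrow> c \<in> problem_consts P" for c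
  proof -
    have "(\<exists>f<?x. (f \<in> set_decode (universal_code ?x) \<or> f \<in> set_decode (initial_code ?x)) \<and>
        f \<in> set_decode (occurs_mask ?x (tm_code (Const c)))) \<longleftrightarrow>
        (\<exists>\<phi>\<in>universal_part P \<union> initial_part P. fm_code \<phi> < ?x \<and>
          fm_code \<phi> \<in> set_decode (occurs_mask ?x (tm_code (Const c))))"
      by (simp add: problem_code_parts fin del: tm_code.simps) blast
    also have "\<dots> \<longleftrightarrow> c \<in> problem_consts P"
      using member_less_problem_code(1)[OF P] unfolding occurs_mask_iff problem_consts_def by blast
    finally show ?thesis .
  qed
  have t: "(?t = 0 \<or> pfst ?t = 1 \<and>
        (\<exists>f<?x. (f \<in> set_decode (universal_code ?x) \<or> f \<in> set_decode (initial_code ?x)) \<and>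
           f \<in> set_decode (occurs_mask ?x ?t)))
      \<longleftrightarrow> ?t \<in> tm_code ` insert (Var 0) (Const ` problem_consts P)"
  proof (cases "pfst ?t = 1")
    case True
    then have "?t = tm_code (Const (psnd ?t))" by (metis prod_encode_pfst_psnd tm_code.simps(2))
    moreover have "tm_code (Const c) \<noteq> tm_code (Var 0)" for c by simp
    moreover have "tm_code (Var 0) = 0" by (simp add: prod_encode_def)
    ultimately show ?thesis
      using occ[of "psnd ?t"] True by (auto simp: image_iff tm_code_eq_iff simp del: tm_code.simps)
  next
    case False
    have "tm_code (Var 0) = 0" by (simp add: prod_encode_def)
    then show ?thesis using False by auto
  qed
  have "is_index_code ?x v \<longleftrightarrow> ?b \<le> 1 \<and> set_decode ?j \<subseteq> step_code ` nonground_steps P \<and>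
      ?t \<in> tm_code ` insert (Var 0) (Const ` problem_consts P)"
    unfolding is_index_code_def J t ..
  also have "\<dots> \<longleftrightarrow> v \<in> index_code ` indices P"
  proof
    assume R: "?b \<le> 1 \<and> set_decode ?j \<subseteq> step_code ` nonground_steps P \<and>
      ?t \<in> tm_code ` insert (Var 0) (Const ` problem_consts P)"
    then obtain J where J: "J \<subseteq> nonground_steps P" "set_decode ?j = step_code ` J"
      by (meson subset_imageE)
    from R obtain t where t: "t \<in> insert (Var 0) (Const ` problem_consts P)" "?t = tm_code t" by blast
    have "?b = of_bool (?b = 1)" using R by auto
    moreover have "?j = set_encode (step_code ` J)" using J(2) by (metis set_decode_inverse)
    ultimately have "v = index_code (?b = 1, J, t)"
      using v t(2) by simp
    moreover have "(?b = 1, J, t) \<in> indices P" using J t by (auto simp: indices_def)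
    ultimately show "v \<in> index_code ` indices P" by blast
  next
    assume "v \<in> index_code ` indices P"
    then obtain b J t where i: "(b, J, t) \<in> indices P" "v = index_code (b, J, t)"
      by (metis imageE surj_pair)
    have "finite J" using i finite_index_set[OF P] by blast
    with i show "?b \<le> 1 \<and> set_decode ?j \<subseteq> step_code ` nonground_steps P \<and>
      ?t \<in> tm_code ` insert (Var 0) (Const ` problem_consts P)"
      by (auto simp: indices_def simp del: tm_code.simps)
  qed
  finally show ?thesis .
qed

text \<open>The bounded search of \<open>reduct_code\<close> meets every index exactly once: the
  bound misses none and the coding is injective.\<close>

lemma sum_index_codes:
  assumes P: "monodic_problem P"
  shows "(\<Sum>v<index_bound (problem_code P). if is_index_code (problem_code P) v then f v else 0)
    = (\<Sum>i\<in>indices P. f (index_code i))"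
proof -
  have "(\<Sum>v<index_bound (problem_code P). if is_index_code (problem_code P) v then f v else 0)
      = (\<Sum>v\<in>{..<index_bound (problem_code P)} \<inter> index_code ` indices P. f v)"
    by (simp add: is_index_code_iff[OF P] sum.inter_restrict)
  also have "{..<index_bound (problem_code P)} \<inter> index_code ` indices P = index_code ` indices P"
    using index_code_less[OF P] by blast
  finally show ?thesis by (simp add: sum.reindex[OF inj_on_index_code[OF P]])
qed

lemma set_encode_Un:
  "finite A \<Longrightarrow> finite B \<Longrightarrow> A \<inter> B = {} \<Longrightarrow> set_encode (A \<union> B) = set_encode A + set_encode B"
  unfolding set_encode_def by (rule sum.union_disjoint)

lemma inj_on_image_comp: "inj g \<Longrightarrow> inj_on f A \<Longrightarrow> inj_on (\<lambda>a. g (f a)) A"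
  unfolding inj_on_def by blast

lemma set_encode_image: "inj_on f A \<Longrightarrow> set_encode (f ` A) = (\<Sum>a\<in>A. 2 ^ f a)"
  by (simp add: set_encode_def sum.reindex)

lemma fm_code_index_axiom:
  assumes "monodic_problem P" "i \<in> indices P"
  shows "fm_code (index_axiom N i) = index_axiom_code N (index_code i)"
proof -
  obtain b J t where i: "i = (b, J, t)" by (metis surj_pair)
  have J: "finite J" using assms i finite_index_set by blast
  have left: "fm_code (index_fm left_lit i) = index_fm_code (\<lambda>n. pfst (psnd n)) (index_code i)"
    unfolding i by (rule fm_code_index_fm[OF J]) (rule lit_code_left_lit)
  have right: "fm_code (index_fm right_lit i) = index_fm_code (\<lambda>n. psnd (psnd n)) (index_code i)"
    unfolding i by (rule fm_code_index_fm[OF J]) (rule lit_code_right_lit)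
  show ?thesis
    unfolding index_axiom_def index_axiom_code_def left_name_def right_name_def
    by (simp only: fm_code.simps list.map list_encode.simps left right)
qed

lemma step_code_index_step: "step_code (index_step N i) = index_step_code N (index_code i)"
  unfolding index_step_def index_step_code_def left_name_def right_name_def
  by (simp only: step_code.simps lit_code.simps)

text \<open>Freshness of the names, through \<open>index_axiom_notin\<close> and
  \<open>index_step_notin\<close>, supplies the disjointness under which adding canonical indices is
  taking unions.\<close>

lemma reduct_code:
  assumes P: "monodic_problem P"
  shows "reduct_code (problem_code P) = problem_code (reduct P)"
proof -
  let ?x = "problem_code P" and ?G = "{s \<in> step_part P. ground_step s}"
  have fin: "finite (universal_part P)" "finite (step_part P)" "finite (indices P)"
    using P by (auto simp: monodic_problem_def finite_indices)
  have "set_encode (fm_code ` (index_axiom ?x ` indices P))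
      = (\<Sum>i\<in>indices P. 2 ^ fm_code (index_axiom ?x i))"
    using set_encode_image[OF inj_on_image_comp[OF inj_fm_code inj_on_index_axiom[OF P]], of ?x]
    by (simp add: image_image)
  also have "\<dots> = (\<Sum>i\<in>indices P. 2 ^ index_axiom_code ?x (index_code i))"
    using fm_code_index_axiom[OF P] by simp
  finally have U: "set_encode (fm_code ` universal_part (reduct P)) =
      set_encode (fm_code ` universal_part P)
        + (\<Sum>i\<in>indices P. 2 ^ index_axiom_code ?x (index_code i))"
    using index_axiom_notin[OF P] fin
    by (simp add: reduct_def image_Un) (subst set_encode_Un; auto simp: fm_code_eq_iff)
  have "set_encode (step_code ` (index_step ?x ` indices P))
      = (\<Sum>i\<in>indices P. 2 ^ index_step_code ?x (index_code i))"
    using set_encode_image[OF inj_on_image_comp[OF inj_step_code inj_on_index_step[OF P]], of ?x]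
    by (simp add: image_image step_code_index_step)
  then have S: "set_encode (step_code ` step_part (reduct P)) =
      set_encode (step_code ` ?G) + (\<Sum>i\<in>indices P. 2 ^ index_step_code ?x (index_code i))"
    using index_step_notin[OF P] fin
    by (simp add: reduct_def image_Un) (subst set_encode_Un; auto simp: inj_eq[OF inj_step_code])
  have "(\<Sum>n<steps_code ?x. if n \<in> set_decode (steps_code ?x) \<and> pfst n = 0 then (2 :: nat) ^ n else 0)
      = (\<Sum>n\<in>{n. n < steps_code ?x \<and> n \<in> set_decode (steps_code ?x) \<and> pfst n = 0}. 2 ^ n)"
    by (rule sum.mono_neutral_cong_right) auto
  also have "{n. n < steps_code ?x \<and> n \<in> set_decode (steps_code ?x) \<and> pfst n = 0} = step_code ` ?G"
  proof -
    have "n \<in> set_decode (steps_code ?x) \<and> pfst n = 0 \<longleftrightarrow> n \<in> step_code ` ?G" for n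
      by (auto simp: problem_code_parts fin pfst_step_code)
    then have "n < steps_code ?x \<and> n \<in> set_decode (steps_code ?x) \<and> pfst n = 0
        \<longleftrightarrow> n \<in> step_code ` ?G" for n
      using set_decode_less[of n "steps_code ?x"] by metis
    then show ?thesis by (intro set_eqI) (simp only: mem_Collect_eq)
  qed
  finally have G: "(\<Sum>n<steps_code ?x. if n \<in> set_decode (steps_code ?x) \<and> pfst n = 0 then 2 ^ n else 0)
      = set_encode (step_code ` ?G)" by (simp add: set_encode_def)
  show ?thesis
    unfolding reduct_code_def G problem_code_eq[of "reduct P"] U S sum_index_codes[OF P]
    by (simp add: problem_code_parts reduct_def)
qed

lemma effective_reduct: "effective_on {P. ground_eventuality_problem P} reduct"
  unfolding effective_on_def
proof (intro exI conjI ballI)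
  show "recursive 1 (\<lambda>xs. reduct_code (xs ! 0))"
    using recursive_reduct_code by (simp add: recursive1_def)
  show "reduct_code ([problem_code P] ! 0) = problem_code (reduct P)"
    if "P \<in> {P. ground_eventuality_problem P}" for P
    using that reduct_code by (simp add: ground_eventuality_problem_def)
qed

theorem theorem6:
  shows "\<exists>(F :: problem \<Rightarrow> problem) (c :: nat).
    effective_on {P. ground_eventuality_problem P} F \<and>
    (\<forall>P. ground_eventuality_problem P \<longrightarrow>
       grounded_problem (F P) \<and>
       satisfiability_equivalent P (F P) \<and>
       problem_size (F P) \<le> 2 ^ (c * problem_size P))"
proof (intro exI conjI allI impI)
  show "effective_on {P. ground_eventuality_problem P} reduct" by (rule effective_reduct)
  fix P assume P: "ground_eventuality_problem P"
  show "grounded_problem (reduct P)" using P by (rule grounded_reduct)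
  show "satisfiability_equivalent P (reduct P)"
    using satisfiable_reduct[OF P] satisfiable_if_satisfiable_reduct[OF P]
    by (auto simp: satisfiability_equivalent_def)
  show "problem_size (reduct P) \<le> 2 ^ (10 * problem_size P)" using P by (rule problem_size_reduct)
qed

end
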